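(* Let $0<q<1$, let $s,x,y\in\mathbb{C}\setminus\{0\}$ with $|sxy|<1$ and $x^2,y^2\ne q^{-l}$ for $l=0,1,2,\dots$, and let $n,m\in\mathbb{Z}$. Put $$S:=\sum_{k=-\infty}^\infty s^k\,y^{n+k}\,\frac{(y^2;q)_\infty}{(q;q)_\infty}\,{}_1\phi_1(0;y^2;q,q^{n+k+1})\;x^{m+k}\,\frac{(x^2;q)_\infty}{(q;q)_\infty}\,{}_1\phi_1(0;x^2;q,q^{m+k+1}).$$ (i) If neither $s^{-1}xy^{-1}$ nor $q^{n-m}s^{-1}xy^{-1}$ is a non-positive integer power of $q$, then $$S=s^{-m}\,y^{n-m}\,\frac{(s^{-1}xy^{-1};q)_\infty\,(y^2;q)_\infty}{(sxy;q)_\infty\,(q;q)_\infty}\,{}_2\phi_1\!\left[{qsx^{-1}y,\;sxy\atop y^2};q,q^{n-m}s^{-1}xy^{-1}\right].$$ (ii) If neither $s^{-1}yx^{-1}$ nor $q^{m-n}s^{-1}yx^{-1}$ is a non-positive integer power of $q$, then $$S=s^{-n}\,x^{m-n}\,\frac{(s^{-1}yx^{-1};q)_\infty\,(x^2;q)_\infty}{(sxy;q)_\infty\,(q;q)_\infty}\,{}_2\phi_1\!\left[{qsxy^{-1},\;sxy\atop x^2};q,q^{m-n}s^{-1}yx^{-1}\right].$$ In particular, when the conditions of both (i) and (ii) hold, the two right-hand expressions are equal.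
   Context: For $0<q<1$ and $a\in\mathbb{C}$: $(a;q)_0:=1$, $(a;q)_k:=\prod_{j=0}^{k-1}(1-aq^j)$, $(a;q)_\infty:=\lim_{k\to\infty}(a;q)_k$. For $w\notin\{1,q^{-1},q^{-2},\dots\}$, ${}_1\phi_1(0;w;q,z):=\sum_{k=0}^\infty\frac{(-1)^k q^{k(k-1)/2} z^k}{(w;q)_k\,(q;q)_k}$. A non-positive integer power of $q$ is an element of $\{q^{-l}: l=0,1,2,\dots\}$. For $c$ not a non-positive integer power of $q$, ${}_2\phi_1\!\left[{a,b\atop c};q,z\right]$ denotes $\sum_{k=0}^\infty\frac{(a;q)_k(b;q)_k}{(c;q)_k(q;q)_k}z^k$ for $|z|<1$ and, for other $z$, its analytic continuation to $\mathbb{C}\setminus\{q^{-l}: l=0,1,2,\dots\}$ (this single-valued continuation exists, with at most poles at the points $q^{-l}$). *)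

theory Defs
  imports "HOL-Complex_Analysis.Complex_Analysis"
begin

definition qpoch :: "complex \<Rightarrow> real \<Rightarrow> nat \<Rightarrow> complex" where
  "qpoch a q k = (\<Prod>j<k. 1 - a * complex_of_real q ^ j)"

definition qpoch_inf :: "complex \<Rightarrow> real \<Rightarrow> complex" where
  "qpoch_inf a q = lim (\<lambda>k. qpoch a q k)"

definition nonpos_qpowers :: "real \<Rightarrow> complex set" where
  "nonpos_qpowers q = range (\<lambda>l::nat. complex_of_real q powi (- int l))"

text \<open>\<open>phi11 w q z\<close> is the series with upper parameter \<open>0\<close> and lower parameter \<open>w\<close>;
  it is only meaningful for \<open>w \<notin> nonpos_qpowers q\<close>.\<close>

definition phi11 :: "complex \<Rightarrow> real \<Rightarrow> complex \<Rightarrow> complex" where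
  "phi11 w q z =
     (\<Sum>k. (-1) ^ k * complex_of_real q ^ (k * (k - 1) div 2) * z ^ k /
          (qpoch w q k * qpoch (complex_of_real q) q k))"

definition phi21_series :: "complex \<Rightarrow> complex \<Rightarrow> complex \<Rightarrow> real \<Rightarrow> complex \<Rightarrow> complex" where
  "phi21_series a b c q z =
     (\<Sum>k. qpoch a q k * qpoch b q k / (qpoch c q k * qpoch (complex_of_real q) q k) * z ^ k)"

text \<open>Outside the unit disc, \<open>phi21\<close> is the value of the analytic continuation of the series to
  the complement of \<open>nonpos_qpowers q\<close>. This complement is a connected open set containing the
  open unit disc, so a continuation is unique; at the points of \<open>nonpos_qpowers q\<close> themselves
  the value is unspecified.\<close>

definition phi21 :: "complex \<Rightarrow> complex \<Rightarrow> complex \<Rightarrow> real \<Rightarrow> complex \<Rightarrow> complex" where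
  "phi21 a b c q z =
     (if norm z < 1 then phi21_series a b c q z
      else (THE v. \<exists>F. F holomorphic_on (- nonpos_qpowers q) \<and>
                       (\<forall>u. norm u < 1 \<longrightarrow> F u = phi21_series a b c q u) \<and> F z = v))"

end

theory Submission
  imports Defs
begin

text \<open>Write \<open>p = sxy\<close>, \<open>b = x\<^sup>2\<close>, \<open>c = y\<^sup>2\<close>, \<open>u = b/p\<close>, \<open>d = n - m\<close>. The normalised Bessel factors
  \<open>qbessel k w\<close> have the generating function \<open>(w/t)\<^sub>\<infinity> / (t)\<^sub>\<infinity>\<close> in \<open>0 < |t| < 1\<close>, by Euler's two
  expansions and the symmetry \<open>(w)\<^sub>\<infinity> 1\<phi>1(0;w;z) = (z)\<^sub>\<infinity> 1\<phi>1(0;z;w)\<close>. Up to an elementary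
  factor the bilateral sum is the sum over \<open>k\<close> of \<open>p\<^sup>k qbessel (k + d) c qbessel k b\<close>. Expanding
  the first factor in powers of \<open>q\<^sup>k\<close> and summing over \<open>k\<close> by the generating function gives the
  \<open>2\<phi>1\<close> series; the interchange is absolutely convergent exactly when the argument \<open>z\<close>, namely
  \<open>u\<close> times the \<open>d\<close>-th power of \<open>q\<close>, satisfies \<open>|z| < 1\<close>. The remaining \<open>d\<close> are reached
  downwards: as a function of \<open>d\<close> the sum satisfies the same second-order recurrence as the
  \<open>q\<close>-difference equation of \<open>2\<phi>1\<close>, which also yields the analytic continuation of \<open>2\<phi>1\<close>.
  Part (ii) is part (i) with \<open>(n, y)\<close> and \<open>(m, x)\<close> exchanged.\<close>

section \<open>General facts on series\<close>

lemma summable_norm_ratio_limit: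
  fixes f :: "nat \<Rightarrow> 'a::real_normed_vector"
  assumes "c \<longlonglongrightarrow> l" "l < 1" and step: "\<And>n. norm (f (Suc n)) \<le> c n * norm (f n)"
  shows "summable (\<lambda>n. norm (f n))"
proof -
  obtain r where r: "l < r" "r < 1" using assms(2) dense by blast
  have "eventually (\<lambda>n. c n < r) sequentially"
    using assms(1) r(1) by (rule order_tendstoD)
  then obtain N where N: "\<And>n. n \<ge> N \<Longrightarrow> c n < r"
    by (auto simp: eventually_at_top_linorder)
  show ?thesis
  proof (rule summable_ratio_test[OF r(2)])
    fix n assume "n \<ge> N"
    have "norm (f (Suc n)) \<le> c n * norm (f n)" by (rule step)
    also have "\<dots> \<le> r * norm (f n)"
      using N[OF \<open>n \<ge> N\<close>] by (intro mult_right_mono) auto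
    finally show "norm (norm (f (Suc n))) \<le> r * norm (norm (f n))" by simp
  qed
qed

text \<open>Replacing \<open>z\<close> by \<open>z * r\<close> multiplies the \<open>k\<close>-th
  coefficient by \<open>r ^ k\<close>, so a coefficient recurrence with multipliers quadratic in
  \<open>r ^ k\<close> becomes a \<open>q\<close>-difference equation. The condition
  \<open>a0 + a1 + a2 = 0\<close> makes the left multiplier vanish at index 0, which the recurrence
  does not reach.\<close>

lemma powser_qdiff:
  fixes t :: "nat \<Rightarrow> complex"
  assumes sm: "summable (\<lambda>k. t k * z ^ k)" "summable (\<lambda>k. t k * (z * r) ^ k)"
      "summable (\<lambda>k. t k * (z * r\<^sup>2) ^ k)"
    and rec: "\<And>k. t (Suc k) * (a0 + a1 * r ^ Suc k + a2 * (r ^ Suc k)\<^sup>2)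
      = t k * (b0 + b1 * r ^ k + b2 * (r ^ k)\<^sup>2)"
    and a: "a0 + a1 + a2 = 0"
  defines "F \<equiv> \<lambda>z. \<Sum>k. t k * z ^ k"
  shows "a0 * F z + a1 * F (z * r) + a2 * F (z * r\<^sup>2)
    = z * (b0 * F z + b1 * F (z * r) + b2 * F (z * r\<^sup>2))"
proof -
  define U where "U x0 x1 x2 k = x0 * (t k * z ^ k) + x1 * (t k * (z * r) ^ k)
    + x2 * (t k * (z * r\<^sup>2) ^ k)"
    for x0 x1 x2 k
  have U: "U x0 x1 x2 sums (x0 * F z + x1 * F (z * r) + x2 * F (z * r\<^sup>2))" for x0 x1 x2
    unfolding U_def F_def by (intro sums_add sums_mult summable_sums sm)
  have U_eq: "U x0 x1 x2 k = t k * (x0 + x1 * r ^ k + x2 * (r ^ k)\<^sup>2) * z ^ k" for x0 x1 x2 k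
    unfolding U_def by (simp add: algebra_simps power_mult_distrib flip: power_mult)
  have "U a0 a1 a2 (Suc k) = z * U b0 b1 b2 k" for k
    unfolding U_eq rec by simp
  moreover have "U a0 a1 a2 0 = 0"
    unfolding U_eq using a by simp
  ultimately have "U a0 a1 a2 sums (z * (b0 * F z + b1 * F (z * r) + b2 * F (z * r\<^sup>2)))"
    using sums_mult[OF U[of b0 b1 b2], of z] sums_Suc_iff[of "U a0 a1 a2"] by simp
  with U[of a0 a1 a2] show ?thesis by (rule sums_unique2)
qed

lemma has_sum_sub:
  fixes f g :: "'a \<Rightarrow> complex"
  assumes "(f has_sum a) B" "(g has_sum b) B"
  shows "((\<lambda>x. f x - g x) has_sum (a - b)) B"
  using has_sum_add[OF assms(1) has_sum_uminusI[OF assms(2)]] by simp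

lemma has_sum_int_nat:
  assumes "\<And>n. n < 0 \<Longrightarrow> f n = 0" and "((\<lambda>i. f (int i)) has_sum S) UNIV"
  shows "(f has_sum S) (UNIV :: int set)"
proof -
  have "(f has_sum S) (range int)"
    using assms(2) by (subst has_sum_reindex) (auto simp: o_def)
  moreover have "f n = 0" if "n \<notin> range int" for n
    using that assms(1)[of n] by (metis nonneg_int_cases not_less rangeI)
  ultimately show ?thesis
    using has_sum_cong_neutral[of UNIV "range int" f f S] by auto
qed

lemma has_sum_Times_mult:
  fixes f :: "'a \<Rightarrow> complex" and g :: "'b \<Rightarrow> complex"
  assumes "(\<lambda>x. norm (f x)) summable_on A" "(\<lambda>y. norm (g y)) summable_on B"
  shows "(\<lambda>z. norm (case z of (x, y) \<Rightarrow> f x * g y)) summable_on A \<times> B"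
    and "((\<lambda>(x, y). f x * g y) has_sum (infsum f A * infsum g B)) (A \<times> B)"
proof -
  show *: "(\<lambda>z. norm (case z of (x, y) \<Rightarrow> f x * g y)) summable_on A \<times> B"
    unfolding Infinite_Sum.abs_summable_on_Sigma_iff
    using assms by (auto simp: norm_mult abs_mult infsum_cmult_right'
        intro!: summable_on_cmult_right summable_on_cmult_left infsum_nonneg)
  then have s: "(\<lambda>(x, y). f x * g y) summable_on A \<times> B"
    by (rule abs_summable_summable)
  then have "infsum (\<lambda>(x, y). f x * g y) (A \<times> B) = infsum (\<lambda>x. infsum (\<lambda>y. f x * g y) B) A"
    by (rule infsum_Sigma'_banach[symmetric])
  also have "\<dots> = infsum f A * infsum g B"
    by (simp add: infsum_cmult_right' infsum_cmult_left')
  finally show "((\<lambda>(x, y). f x * g y) has_sum (infsum f A * infsum g B)) (A \<times> B)"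
    using has_sum_infsum[OF s] by simp
qed

text \<open>Cauchy product of a bilateral and a one-sided series: the shear from
  \<open>(k, j)\<close> to \<open>(k + int j, j)\<close> is a bijection of the index set and turns
  the double series into a plain product. The explicit norm bound later serves for an estimate with
  a parameter.\<close>

lemma
  fixes \<alpha> :: "int \<Rightarrow> complex" and \<beta> :: "nat \<Rightarrow> complex"
  assumes \<alpha>: "(\<lambda>n. norm (\<alpha> n)) summable_on UNIV" and \<beta>: "(\<lambda>j. norm (\<beta> j)) summable_on UNIV"
    and g: "\<And>k. ((\<lambda>j. \<alpha> (k + int j) * \<beta> j) has_sum g k) UNIV"
  shows laurent_product_has_sum: "(g has_sum (infsum \<alpha> UNIV * infsum \<beta> UNIV)) UNIV"
    and laurent_product_abs_summable: "(\<lambda>k. norm (g k)) summable_on UNIV"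
    and laurent_product_norm_le: "(\<Sum>\<^sub>\<infinity>k. norm (g k))
      \<le> (\<Sum>\<^sub>\<infinity>n. norm (\<alpha> n)) * (\<Sum>\<^sub>\<infinity>j. norm (\<beta> j))"
proof -
  define F where "F = (\<lambda>(k, j). \<alpha> (k + int j) * \<beta> j)"
  have bij: "bij_betw (\<lambda>(k, j). (k + int j, j)) (UNIV \<times> UNIV) (UNIV \<times> (UNIV :: nat set))"
    by (rule bij_betwI[where g = "\<lambda>(n, j). (n - int j, j)"]) auto
  have shift: "((\<lambda>(k, j). h (k + int j, j)) has_sum x) (UNIV \<times> UNIV) \<longleftrightarrow> (h has_sum x) (UNIV \<times> UNIV)"
    for h :: "int \<times> nat \<Rightarrow> 'c::{comm_monoid_add, topological_space}" and x
    using has_sum_reindex_bij_betw[OF bij, of h x] by (simp add: case_prod_unfold)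
  have F: "(F has_sum (infsum \<alpha> UNIV * infsum \<beta> UNIV)) (UNIV \<times> UNIV)"
    using shift[of "\<lambda>(x, y). \<alpha> x * \<beta> y"] has_sum_Times_mult(2)[OF \<alpha> \<beta>] by (simp add: F_def)
  show "(g has_sum (infsum \<alpha> UNIV * infsum \<beta> UNIV)) UNIV"
    by (rule has_sum_SigmaD[OF F]) (simp add: F_def g)
  have nn: "((\<lambda>(x, y). norm (\<alpha> x) * norm (\<beta> y))
    has_sum ((\<Sum>\<^sub>\<infinity>n. norm (\<alpha> n)) * (\<Sum>\<^sub>\<infinity>j. norm (\<beta> j)))) (UNIV \<times> UNIV)"
  proof -
    have s: "(\<lambda>(x, y). norm (\<alpha> x) * norm (\<beta> y)) summable_on (UNIV \<times> UNIV)"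
      using has_sum_Times_mult(1)[OF \<alpha> \<beta>] by (simp add: norm_mult case_prod_unfold)
    then have "infsum (\<lambda>(x, y). norm (\<alpha> x) * norm (\<beta> y)) (UNIV \<times> UNIV)
        = infsum (\<lambda>x. infsum (\<lambda>y. norm (\<alpha> x) * norm (\<beta> y)) UNIV) UNIV"
      by (rule infsum_Sigma'_banach[symmetric])
    then show ?thesis
      using has_sum_infsum[OF s] by (simp add: infsum_cmult_right' infsum_cmult_left')
  qed
  then have NF: "((\<lambda>x. norm (F x)) has_sum ((\<Sum>\<^sub>\<infinity>n. norm (\<alpha> n)) * (\<Sum>\<^sub>\<infinity>j. norm (\<beta> j)))) (UNIV \<times> UNIV)"
    using shift[of "\<lambda>(x, y). norm (\<alpha> x) * norm (\<beta> y)"]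
    by (simp add: F_def norm_mult case_prod_unfold)
  define N where "N k = (\<Sum>\<^sub>\<infinity>j. norm (F (k, j)))" for k
  have Fk: "(\<lambda>j. norm (F (k, j))) summable_on UNIV" for k
    using NF Infinite_Sum.abs_summable_on_Sigma_iff[of F UNIV "\<lambda>_. UNIV"] unfolding summable_on_def
      by auto
  have N: "(N has_sum ((\<Sum>\<^sub>\<infinity>n. norm (\<alpha> n)) * (\<Sum>\<^sub>\<infinity>j. norm (\<beta> j)))) UNIV"
    by (rule has_sum_SigmaD[OF NF]) (simp add: N_def Fk)
  have le: "norm (g k) \<le> N k" for k
    by (rule norm_infsum_le[OF g[of k] has_sum_infsum[OF Fk[of k], folded N_def]])
      (simp add: F_def)
  have "N summable_on UNIV" using N by (auto simp: summable_on_def)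
  then show *: "(\<lambda>k. norm (g k)) summable_on UNIV"
    by (rule Infinite_Sum.abs_summable_on_comparison_test') (use le in auto)
  have "(\<Sum>\<^sub>\<infinity>k. norm (g k)) \<le> (\<Sum>\<^sub>\<infinity>k. N k)"
    by (rule infsum_mono) (use * \<open>N summable_on UNIV\<close> le in auto)
  then show "(\<Sum>\<^sub>\<infinity>k. norm (g k)) \<le> (\<Sum>\<^sub>\<infinity>n. norm (\<alpha> n)) * (\<Sum>\<^sub>\<infinity>j. norm (\<beta> j))"
    using infsumI[OF N] by simp
qed

section \<open>Finite \<open>q\<close>-shifted factorials\<close>

lemma qpoch_0 [simp]: "qpoch a q 0 = 1"
  by (simp add: qpoch_def)

lemma qpoch_Suc: "qpoch a q (Suc k) = qpoch a q k * (1 - a * complex_of_real q ^ k)"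
  by (simp add: qpoch_def)

lemma qpoch_Suc_left: "qpoch a q (Suc k) = (1 - a) * qpoch (a * complex_of_real q) q k"
  unfolding qpoch_def by (subst prod.lessThan_Suc_shift) (simp add: mult.assoc)

section \<open>Infinite \<open>q\<close>-shifted factorials\<close>

locale q_base =
  fixes q :: real
  assumes q_pos: "0 < q" and q_less_1: "q < 1"
begin

abbreviation Q :: complex where "Q \<equiv> complex_of_real q"

lemma Q_nonzero [simp]: "Q \<noteq> 0"
  using q_pos by simp

lemma Q_powi_add: "Q powi (m + n) = Q powi m * Q powi n"
  by (rule power_int_add) (use Q_nonzero in blast)

lemma norm_Q: "norm Q = q"
  using q_pos by simp

lemma norm_Q_power_le_1: "norm (Q ^ k) \<le> 1"
  using q_pos q_less_1 by (simp add: norm_power norm_Q power_le_one)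

lemma Q_power_LIMSEQ: "(\<lambda>k. Q ^ k) \<longlonglongrightarrow> 0"
  by (rule LIMSEQ_power_zero) (use q_pos q_less_1 in simp)

lemma nonpos_qpowers_iff: "c \<in> nonpos_qpowers q \<longleftrightarrow> (\<exists>l. c * Q ^ l = 1)"
proof -
  have "c = Q powi (- int l) \<longleftrightarrow> c * Q ^ l = 1" for l
    using Q_nonzero by (auto simp: power_int_minus field_simps simp del: of_real_eq_0_iff)
  then show ?thesis by (auto simp: nonpos_qpowers_def)
qed

lemma nonpos_qpowers_norm: "c \<in> nonpos_qpowers q \<Longrightarrow> norm c \<ge> 1"
proof -
  assume "c \<in> nonpos_qpowers q"
  then obtain l where "c * Q ^ l = 1" by (auto simp: nonpos_qpowers_iff)
  then have "norm c * norm (Q ^ l) = 1" by (metis norm_mult norm_one)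
  moreover have "norm c * norm (Q ^ l) \<le> norm c * 1"
    by (intro mult_left_mono norm_Q_power_le_1) auto
  ultimately show ?thesis by simp
qed

lemma mult_Q_notin_nonpos_qpowers:
  "c \<notin> nonpos_qpowers q \<Longrightarrow> c * Q \<notin> nonpos_qpowers q"
  unfolding nonpos_qpowers_iff by (metis mult.assoc power_Suc)

lemma qpoch_nonzero: "c \<notin> nonpos_qpowers q \<Longrightarrow> qpoch c q k \<noteq> 0"
  by (auto simp: qpoch_def nonpos_qpowers_iff)

lemma Q_notin_nonpos_qpowers [simp]: "Q \<notin> nonpos_qpowers q"
  using nonpos_qpowers_norm[of Q] norm_Q q_less_1 by auto

lemma qpoch_Q_nonzero [simp]: "qpoch Q q k \<noteq> 0"
  by (rule qpoch_nonzero) simp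

lemma one_minus_Q_power_nonzero: "1 - Q ^ Suc k \<noteq> 0"
  using qpoch_Q_nonzero[of "Suc k"] unfolding qpoch_Suc by simp

section \<open>Euler's expansion of \<open>qpoch_inf z q\<close> in powers of \<open>z\<close>, with
  coefficients \<open>euler_coeff\<close>\<close>

definition euler_coeff :: "nat \<Rightarrow> complex" where
  "euler_coeff i = (-1) ^ i * Q ^ (i * (i - 1) div 2) / qpoch Q q i"

lemma euler_coeff_0 [simp]: "euler_coeff 0 = 1" by (simp add: euler_coeff_def)

lemma triangle_Suc: "Suc i * (Suc i - 1) div 2 = i * (i - 1) div 2 + i"
proof (cases i)
  case (Suc j)
  have "Suc i * (Suc i - 1) = i * (i - 1) + 2 * i"
    unfolding Suc by (simp add: algebra_simps)
  then show ?thesis by simp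
qed simp

lemma euler_coeff_Suc: "euler_coeff (Suc i) = - (Q ^ i / (1 - Q ^ Suc i)) * euler_coeff i"
  unfolding euler_coeff_def triangle_Suc qpoch_Suc by (simp add: power_add mult_ac)

lemma euler_coeff_Suc_mult: "euler_coeff (Suc i) * (1 - Q ^ Suc i) = - (Q ^ i) * euler_coeff i"
  unfolding euler_coeff_Suc using one_minus_Q_power_nonzero[of i] by (simp add: field_simps)

lemma summable_norm_euler_coeff: "summable (\<lambda>i. norm (euler_coeff i * z ^ i))"
proof (rule summable_norm_ratio_limit)
  have "(\<lambda>i. norm (Q ^ i / (1 - Q ^ Suc i) * z)) \<longlonglongrightarrow> norm (0 / (1 - 0) * z)"
    by (intro tendsto_intros Q_power_LIMSEQ LIMSEQ_Suc[OF Q_power_LIMSEQ]) auto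
  then show "(\<lambda>i. norm (Q ^ i / (1 - Q ^ Suc i) * z)) \<longlonglongrightarrow> 0" by simp
  show "norm (euler_coeff (Suc i) * z ^ Suc i)
      \<le> norm (Q ^ i / (1 - Q ^ Suc i) * z) * norm (euler_coeff i * z ^ i)" for i
    unfolding euler_coeff_Suc by (simp add: norm_mult norm_divide mult_ac)
qed simp

lemma summable_euler_coeff: "summable (\<lambda>i. euler_coeff i * z ^ i)"
  by (rule summable_norm_cancel) (rule summable_norm_euler_coeff)

text \<open>\<open>qpoch_inf\<close> is a \<open>lim\<close>, so its value is known only once
  convergence is proved; this series is the candidate for the limit, confirmed in
  \<open>qpoch_inf_eq\<close>.\<close>

definition euler_fun :: "complex \<Rightarrow> complex" where
  "euler_fun z = (\<Sum>i. euler_coeff i * z ^ i)"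

lemma euler_fun_rec: "euler_fun z = (1 - z) * euler_fun (z * Q)"
proof -
  have "1 * euler_fun z + (-1) * euler_fun (z * Q) + 0 * euler_fun (z * Q\<^sup>2)
      = z * (0 * euler_fun z + (-1) * euler_fun (z * Q) + 0 * euler_fun (z * Q\<^sup>2))"
    unfolding euler_fun_def
    by (rule powser_qdiff[OF summable_euler_coeff summable_euler_coeff summable_euler_coeff])
      (use euler_coeff_Suc_mult in \<open>auto simp: algebra_simps\<close>)
  then show ?thesis by (simp add: algebra_simps)
qed

lemma euler_fun_iterate: "euler_fun z = qpoch z q k * euler_fun (z * Q ^ k)"
proof (induction k)
  case (Suc k)
  then show ?case using euler_fun_rec[of "z * Q ^ k"] by (simp add: qpoch_Suc mult_ac)
qed simp

text \<open>Continuity of a power series at 0, read along \<open>z * Q ^ k\<close>. It evaluates the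
  factor left over after iterating a first-order \<open>q\<close>-difference equation.\<close>

lemma powser_Q_LIMSEQ:
  fixes a :: "nat \<Rightarrow> complex"
  assumes "s > 0" and "\<And>x. norm x < s \<Longrightarrow> summable (\<lambda>i. a i * x ^ i)"
  shows "(\<lambda>k. \<Sum>i. a i * (z * Q ^ k) ^ i) \<longlonglongrightarrow> a 0"
proof -
  have "((\<lambda>x. \<Sum>i. a i * x ^ i) \<longlongrightarrow> a 0) (at 0)"
    by (rule powser_limit_0[OF assms(1)]) (use assms(2) in \<open>auto simp: summable_sums\<close>)
  then have "isCont (\<lambda>x. \<Sum>i. a i * x ^ i) 0"
    by (simp add: isCont_def)
  moreover have "(\<lambda>k. z * Q ^ k) \<longlonglongrightarrow> 0"
    using tendsto_mult[OF tendsto_const[of z] Q_power_LIMSEQ] by simp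
  ultimately have "(\<lambda>k. \<Sum>i. a i * (z * Q ^ k) ^ i) \<longlonglongrightarrow> (\<Sum>i. a i * 0 ^ i)"
    by (rule isCont_tendsto_compose)
  then show ?thesis by simp
qed

text \<open>By \<open>euler_fun_iterate\<close> the partial product is \<open>euler_fun z\<close>
  divided by a factor tending to 1. That factor may vanish for small \<open>k\<close>, hence the
  eventual equality.\<close>

lemma qpoch_LIMSEQ_euler_fun: "(\<lambda>k. qpoch z q k) \<longlonglongrightarrow> euler_fun z"
proof -
  have l: "(\<lambda>k. euler_fun (z * Q ^ k)) \<longlonglongrightarrow> 1"
    unfolding euler_fun_def using powser_Q_LIMSEQ[of 1 euler_coeff z] summable_euler_coeff by simp
  then have "(\<lambda>k. euler_fun z / euler_fun (z * Q ^ k)) \<longlonglongrightarrow> euler_fun z / 1"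
    by (intro tendsto_intros) auto
  moreover have "eventually (\<lambda>k. euler_fun z / euler_fun (z * Q ^ k) = qpoch z q k) sequentially"
    using tendsto_imp_eventually_ne[OF l, of 0]
    by (auto elim!: eventually_mono) (metis euler_fun_iterate nonzero_mult_div_cancel_right)
  ultimately show ?thesis by (simp add: tendsto_cong)
qed

lemma qpoch_inf_eq: "qpoch_inf z q = euler_fun z"
  unfolding qpoch_inf_def by (rule limI) (rule qpoch_LIMSEQ_euler_fun)

lemma qpoch_LIMSEQ: "(\<lambda>k. qpoch z q k) \<longlonglongrightarrow> qpoch_inf z q"
  unfolding qpoch_inf_eq by (rule qpoch_LIMSEQ_euler_fun)

lemma euler_sums: "(\<lambda>i. euler_coeff i * z ^ i) sums qpoch_inf z q"
  unfolding qpoch_inf_eq euler_fun_def by (rule summable_sums) (rule summable_euler_coeff)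

lemma qpoch_inf_split: "qpoch_inf z q = qpoch z q k * qpoch_inf (z * Q ^ k) q"
  unfolding qpoch_inf_eq by (rule euler_fun_iterate)

section \<open>Euler's expansion of the reciprocal of \<open>qpoch_inf t q\<close> in the unit
  disc\<close>

lemma summable_norm_inverse_euler:
  assumes "norm t < 1"
  shows "summable (\<lambda>i. norm (t ^ i / qpoch Q q i))"
proof (rule summable_norm_ratio_limit)
  have "(\<lambda>i. norm (t / (1 - Q ^ Suc i))) \<longlonglongrightarrow> norm (t / (1 - 0))"
    by (intro tendsto_intros LIMSEQ_Suc[OF Q_power_LIMSEQ]) auto
  then show "(\<lambda>i. norm (t / (1 - Q ^ Suc i))) \<longlonglongrightarrow> norm t" by simp
  show "norm (t ^ Suc i / qpoch Q q (Suc i))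
      \<le> norm (t / (1 - Q ^ Suc i)) * norm (t ^ i / qpoch Q q i)" for i
    unfolding qpoch_Suc by (simp add: norm_mult norm_divide mult_ac)
qed (rule assms)

text \<open>The series \<open>e\<close> satisfies \<open>e (z * Q) = (1 - z) * e z\<close>, the
  reciprocal of the equation of the product; iterating from \<open>t\<close> and letting
  \<open>k\<close> grow gives the claim. Stated as a product, it also shows that
  \<open>qpoch_inf t q\<close> has no zero in the unit disc.\<close>

lemma inverse_euler_mult:
  assumes "norm t < 1"
  shows "qpoch_inf t q * (\<Sum>i. t ^ i / qpoch Q q i) = 1"
proof -
  define a where "a i = 1 / qpoch Q q i" for i
  define e where "e z = (\<Sum>i. a i * z ^ i)" for z
  have sm: "summable (\<lambda>i. a i * z ^ i)" if "norm z < 1" for z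
    using summable_norm_cancel[OF summable_norm_inverse_euler[OF that]] by (simp add: a_def)
  have a_Suc: "a (Suc i) * (1 - Q ^ Suc i) = a i" for i
    unfolding a_def qpoch_Suc using one_minus_Q_power_nonzero[of i] by simp
  have rec: "e (z * Q) = (1 - z) * e z" if z: "norm z < 1" for z
  proof -
    have zQ: "norm (z * Q) < 1"
      using z q_pos q_less_1 by (simp add: norm_mult) (metis less_eq_real_def mult_left_le
        norm_ge_zero order.strict_trans1)
    have zQ2: "norm (z * Q\<^sup>2) < 1"
      using z norm_Q_power_le_1[of 2]
      by (simp only: norm_mult) (metis mult_left_le norm_ge_zero order.strict_trans1)
    have "1 * e z + (-1) * e (z * Q) + 0 * e (z * Q\<^sup>2)
        = z * (1 * e z + 0 * e (z * Q) + 0 * e (z * Q\<^sup>2))"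
      unfolding e_def
      by (rule powser_qdiff[OF sm[OF z] sm[OF zQ] sm[OF zQ2]])
        (use a_Suc in \<open>auto simp: algebra_simps\<close>)
    then show ?thesis by (simp add: algebra_simps)
  qed
  have iter: "e (t * Q ^ k) = qpoch t q k * e t" for k
  proof (induction k)
    case (Suc k)
    have "norm (t * Q ^ k) \<le> norm t * 1"
      unfolding norm_mult by (intro mult_left_mono norm_Q_power_le_1) simp
    then have "norm (t * Q ^ k) < 1" using assms by simp
    from rec[OF this] Suc show ?case by (simp add: qpoch_Suc mult_ac)
  qed simp
  have "(\<lambda>k. e (t * Q ^ k)) \<longlonglongrightarrow> 1"
    unfolding e_def using powser_Q_LIMSEQ[of 1 a t] sm by (simp add: a_def)
  moreover have "(\<lambda>k. e (t * Q ^ k)) \<longlonglongrightarrow> qpoch_inf t q * e t"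
    unfolding iter by (intro tendsto_intros qpoch_LIMSEQ)
  ultimately have "qpoch_inf t q * e t = 1" by (rule LIMSEQ_unique[symmetric])
  then show ?thesis by (simp add: e_def a_def)
qed

lemma qpoch_inf_nonzero_small: "norm t < 1 \<Longrightarrow> qpoch_inf t q \<noteq> 0"
  using inverse_euler_mult[of t] by auto

lemma inverse_euler_sums:
  assumes "norm t < 1"
  shows "(\<lambda>i. t ^ i / qpoch Q q i) sums (1 / qpoch_inf t q)"
proof -
  have "(\<Sum>i. t ^ i / qpoch Q q i) = 1 / qpoch_inf t q"
    using inverse_euler_mult[OF assms] qpoch_inf_nonzero_small[OF assms] by (simp add: field_simps)
  with summable_norm_cancel[OF summable_norm_inverse_euler[OF assms]] show ?thesis
    by (simp add: sums_iff)
qed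

lemma qpoch_inf_nonzero:
  assumes "c \<notin> nonpos_qpowers q"
  shows "qpoch_inf c q \<noteq> 0"
proof -
  have "(\<lambda>k. norm (c * Q ^ k)) \<longlonglongrightarrow> norm (c * 0)"
    by (intro tendsto_intros Q_power_LIMSEQ)
  then have "eventually (\<lambda>k. norm (c * Q ^ k) < 1) sequentially"
    by (intro order_tendstoD) auto
  then obtain k where "norm (c * Q ^ k) < 1"
    by (auto simp: eventually_at_top_linorder)
  then show ?thesis
    using qpoch_inf_split[of c k] qpoch_nonzero[OF assms] qpoch_inf_nonzero_small by auto
qed

lemma qpoch_inf_eq_0:
  assumes "c \<in> nonpos_qpowers q"
  shows "qpoch_inf c q = 0"
proof -
  obtain l where "c * Q ^ l = 1" using assms by (auto simp: nonpos_qpowers_iff)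
  then have "qpoch c q (Suc l) = 0" by (simp add: qpoch_Suc)
  then show ?thesis using qpoch_inf_split[of c "Suc l"] by simp
qed

lemma qpoch_inf_Q_nonzero [simp]: "qpoch_inf Q q \<noteq> 0"
  by (rule qpoch_inf_nonzero) simp

lemma qpoch_inf_bounded: "\<exists>K>0. \<forall>i. norm (qpoch_inf (b * Q ^ i) q) \<le> K"
proof -
  have "(\<lambda>k. \<Sum>i. euler_coeff i * (b * Q ^ k) ^ i) \<longlonglongrightarrow> euler_coeff 0"
    using powser_Q_LIMSEQ[of 1 euler_coeff b] summable_euler_coeff by simp
  then have "(\<lambda>k. qpoch_inf (b * Q ^ k) q) \<longlonglongrightarrow> 1"
    by (simp add: qpoch_inf_eq euler_fun_def)
  then show ?thesis
    using convergentI convergent_imp_Bseq BseqE by blast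
qed

lemma euler_coeff_abs_summable: "(\<lambda>i. norm (euler_coeff i * z ^ i)) summable_on UNIV"
  by (subst summable_on_UNIV_nonneg_real_iff) (auto simp: summable_norm_euler_coeff)

lemma euler_has_sum: "((\<lambda>i. euler_coeff i * z ^ i) has_sum qpoch_inf z q) UNIV"
  by (rule norm_summable_imp_has_sum[OF summable_norm_euler_coeff euler_sums])

section \<open>The function \<open>1\<phi>1\<close> and its generating function\<close>

text \<open>This is \<open>(b;q)_\<infinity>\<close> times the series 1phi1, with the quotient
  \<open>(b;q)_\<infinity> / (b;q)_i\<close> written as the infinite product at
  \<open>b * Q ^ i\<close>. It thus makes sense for every \<open>b\<close>, as the exchange of
  \<open>b\<close> and \<open>z\<close> in \<open>phi11_reg_commute\<close> requires.\<close>

definition phi11_reg :: "complex \<Rightarrow> complex \<Rightarrow> complex" where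
  "phi11_reg b z = (\<Sum>i. euler_coeff i * qpoch_inf (b * Q ^ i) q * z ^ i)"

lemma phi11_reg_summable_norm:
  "summable (\<lambda>i. norm (euler_coeff i * qpoch_inf (b * Q ^ i) q * z ^ i))"
proof -
  obtain K where K: "\<And>i. norm (qpoch_inf (b * Q ^ i) q) \<le> K"
    using qpoch_inf_bounded by blast
  show ?thesis
  proof (rule summable_comparison_test'[where N = 0])
    show "summable (\<lambda>i. K * norm (euler_coeff i * z ^ i))"
      by (intro summable_mult summable_norm_euler_coeff)
    show "norm (norm (euler_coeff i * qpoch_inf (b * Q ^ i) q * z ^ i))
      \<le> K * norm (euler_coeff i * z ^ i)" for i
      using mult_right_mono[OF K[of i], of "norm (euler_coeff i * z ^ i)"]
        by (simp add: norm_mult mult_ac)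
  qed
qed

lemma phi11_reg_summable: "summable (\<lambda>i. euler_coeff i * qpoch_inf (b * Q ^ i) q * z ^ i)"
  by (rule summable_norm_cancel[OF phi11_reg_summable_norm])

lemma phi11_reg_has_sum: "((\<lambda>i. euler_coeff i * qpoch_inf (b * Q ^ i) q * z ^ i)
  has_sum phi11_reg b z) UNIV"
  unfolding phi11_reg_def by (intro norm_summable_imp_has_sum phi11_reg_summable_norm summable_sums
    phi11_reg_summable)

text \<open>Expanding the infinite product by Euler gives a double series whose term is symmetric
  under exchanging \<open>(i, z)\<close> and \<open>(j, b)\<close>. The coupling factor
  \<open>Q ^ (i * j)\<close> has norm at most 1, so a product of two Euler series dominates
  it.\<close>

lemma phi11_reg_commute: "phi11_reg b z = phi11_reg z b"
proof -
  define f where "f = (\<lambda>(i, j). (euler_coeff i * z ^ i) * (euler_coeff j * b ^ j) * Q ^ (i * j))"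
  have "(\<lambda>x. norm (case x of (i, j) \<Rightarrow> (euler_coeff i * z ^ i) * (euler_coeff j * b ^ j)))
    summable_on UNIV \<times> UNIV"
    by (intro has_sum_Times_mult euler_coeff_abs_summable)
  then have "(\<lambda>x. norm (f x)) summable_on UNIV \<times> UNIV"
  proof (rule Infinite_Sum.abs_summable_on_comparison_test)
    show "norm (f x) \<le> norm (case x of (i, j) \<Rightarrow> (euler_coeff i * z ^ i) * (euler_coeff j * b ^ j))"
      for x
      using norm_Q_power_le_1 by (auto simp: f_def norm_mult intro!: mult_left_le
        split: prod.splits)
  qed
  then have s: "f summable_on UNIV \<times> UNIV" by (rule abs_summable_summable)
  have 1: "((\<lambda>j. f (i, j)) has_sum (euler_coeff i * qpoch_inf (b * Q ^ i) q * z ^ i)) UNIV" for i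
    using has_sum_cmult_right[OF euler_has_sum[of "b * Q ^ i"], of "euler_coeff i * z ^ i"]
    by (simp add: f_def power_mult_distrib mult_ac power_mult)
  have 2: "((\<lambda>i. f (i, j)) has_sum (euler_coeff j * qpoch_inf (z * Q ^ j) q * b ^ j)) UNIV" for j
    using has_sum_cmult_right[OF euler_has_sum[of "z * Q ^ j"], of "euler_coeff j * b ^ j"]
    by (simp add: f_def power_mult_distrib mult_ac flip: power_mult)
  have "(f has_sum infsum f (UNIV \<times> UNIV)) (UNIV \<times> UNIV)" using s by simp
  from has_sum_SigmaD[OF this 1]
  have "phi11_reg b z = infsum f (UNIV \<times> UNIV)"
    using phi11_reg_has_sum has_sum_unique by blast
  moreover have "((\<lambda>(j, i). f (i, j)) has_sum infsum f (UNIV \<times> UNIV)) (UNIV \<times> UNIV)"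
    using s by (subst has_sum_swap[symmetric]) simp
  from has_sum_SigmaD[OF this, of "\<lambda>j. euler_coeff j * qpoch_inf (z * Q ^ j) q * b ^ j"] 2
  have "((\<lambda>j. euler_coeff j * qpoch_inf (z * Q ^ j) q * b ^ j) has_sum infsum f (UNIV \<times> UNIV)) UNIV"
    by simp
  then have "phi11_reg z b = infsum f (UNIV \<times> UNIV)"
    by (rule has_sum_unique[OF phi11_reg_has_sum])
  ultimately show ?thesis by simp
qed

lemma qpoch_inf_times_phi11:
  assumes "w \<notin> nonpos_qpowers q"
  shows "qpoch_inf w q * phi11 w q z = phi11_reg w z"
proof -
  have nz: "qpoch_inf w q \<noteq> 0" "qpoch w q k \<noteq> 0" for k
    using assms by (simp_all add: qpoch_inf_nonzero qpoch_nonzero)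
  have "(- 1) ^ k * Q ^ (k * (k - 1) div 2) * z ^ k / (qpoch w q k * qpoch Q q k)
      = euler_coeff k * qpoch_inf (w * Q ^ k) q * z ^ k / qpoch_inf w q" for k
    using nz qpoch_inf_split[of w k] by (simp add: euler_coeff_def field_simps)
  then have "phi11 w q z = phi11_reg w z / qpoch_inf w q"
    unfolding phi11_def phi11_reg_def by (simp add: suminf_divide[OF phi11_reg_summable])
  then show ?thesis using nz by simp
qed

text \<open>The left multiplier of the coefficient recurrence factors as
  \<open>(1 - Q ^ Suc k) * (1 - b * Q ^ k)\<close>; the first factor is absorbed by
  \<open>euler_coeff\<close>, the second by the infinite product.\<close>

lemma phi11_reg_qdiff:
  "phi11_reg b z = (1 + b / Q - z) * phi11_reg b (z * Q) - b / Q * phi11_reg b (z * Q\<^sup>2)"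
proof -
  have rec: "euler_coeff (Suc k) * qpoch_inf (b * Q ^ Suc k) q
        * (1 + (- (1 + b / Q)) * Q ^ Suc k + b / Q * (Q ^ Suc k)\<^sup>2)
      = euler_coeff k * qpoch_inf (b * Q ^ k) q * (0 + (-1) * Q ^ k + 0 * (Q ^ k)\<^sup>2)" for k
  proof -
    have *: "1 + (- (1 + b / Q)) * Q ^ Suc k + b / Q * (Q ^ Suc k)\<^sup>2
      = (1 - Q ^ Suc k) * (1 - b * Q ^ k)"
      using Q_nonzero by (simp add: field_simps power2_eq_square del: of_real_eq_0_iff Q_nonzero)
    have "qpoch_inf (b * Q ^ k) q = (1 - b * Q ^ k) * qpoch_inf (b * Q ^ Suc k) q"
      using qpoch_inf_split[of "b * Q ^ k" 1] by (simp add: qpoch_Suc mult_ac)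
    then have "euler_coeff k * qpoch_inf (b * Q ^ k) q * (0 + (-1) * Q ^ k + 0 * (Q ^ k)\<^sup>2)
        = (- (Q ^ k) * euler_coeff k) * ((1 - b * Q ^ k) * qpoch_inf (b * Q ^ Suc k) q)"
      by simp
    also have "\<dots> = euler_coeff (Suc k) * qpoch_inf (b * Q ^ Suc k) q
        * ((1 - Q ^ Suc k) * (1 - b * Q ^ k))"
      unfolding euler_coeff_Suc_mult[symmetric] by (simp only: mult_ac)
    finally show ?thesis unfolding * by (rule sym)
  qed
  have "1 * phi11_reg b z + (- (1 + b / Q)) * phi11_reg b (z * Q) + b / Q * phi11_reg b (z * Q\<^sup>2)
      = z * (0 * phi11_reg b z + (-1) * phi11_reg b (z * Q) + 0 * phi11_reg b (z * Q\<^sup>2))"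
    unfolding phi11_reg_def by (rule powser_qdiff[OF _ _ _ rec]) (auto simp: phi11_reg_summable)
  then show ?thesis by (simp add: algebra_simps)
qed

section \<open>The factors \<open>qbessel\<close> of the stated sum and their generating
  function\<close>

definition qbessel :: "int \<Rightarrow> complex \<Rightarrow> complex" where
  "qbessel k b = phi11_reg b (Q powi (k + 1)) / qpoch_inf Q q"

text \<open>The reciprocal of \<open>qpoch Q q n\<close>, extended to all integers in the manner of
  \<open>1 / Gamma\<close>: for negative \<open>n\<close> the infinite product contains a zero
  factor. One-sided series thereby become bilateral ones.\<close>

definition rfact :: "int \<Rightarrow> complex" where
  "rfact n = qpoch_inf (Q powi (n + 1)) q / qpoch_inf Q q"

lemma rfact_of_nat: "rfact (int i) = 1 / qpoch Q q i"
proof -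
  have "Q powi (int i + 1) = Q * Q ^ i" by (simp add: Q_powi_add)
  moreover have "qpoch_inf (Q * Q ^ i) q \<noteq> 0"
    using qpoch_inf_split[of Q i] by (metis mult_zero_right qpoch_inf_Q_nonzero)
  ultimately show ?thesis
    using qpoch_inf_split[of Q i] by (simp add: rfact_def)
qed

lemma rfact_neg:
  assumes "n < 0"
  shows "rfact n = 0"
proof -
  have "Q powi (n + 1) = Q powi (- int (nat (- n - 1)))" using assms by (simp add: add.commute)
  then have "Q powi (n + 1) \<in> nonpos_qpowers q"
    unfolding nonpos_qpowers_def by blast
  then show ?thesis by (simp add: rfact_def qpoch_inf_eq_0)
qed

lemma rfact_bounded: "\<exists>K. \<forall>n. norm (rfact n) \<le> K"
proof -
  obtain K where K: "K > 0" "\<And>i. norm (qpoch_inf (Q * Q ^ i) q) \<le> K"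
    using qpoch_inf_bounded by blast
  have "norm (rfact n) \<le> K / norm (qpoch_inf Q q)" for n
  proof (cases "n < 0")
    case False
    then obtain i where i: "n = int i" by (metis nonneg_int_cases not_less)
    have "Q powi (int i + 1) = Q * Q ^ i" by (simp add: Q_powi_add)
    then show ?thesis using K(2)[of i] unfolding i rfact_def
      by (simp add: norm_divide divide_right_mono)
  qed (use K in \<open>simp add: rfact_neg\<close>)
  then show ?thesis by blast
qed

text \<open>After parameter and argument are exchanged, \<open>k\<close> enters only through
  \<open>rfact (k + int j)\<close>, which is the shape of a convolution coefficient.\<close>

lemma qbessel_has_sum: "((\<lambda>j. euler_coeff j * b ^ j * rfact (k + int j)) has_sum qbessel k b) UNIV"
proof -
  have "((\<lambda>j. euler_coeff j * qpoch_inf (Q powi (k + 1) * Q ^ j) q * b ^ j / qpoch_inf Q q)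
    has_sum qbessel k b) UNIV"
    unfolding qbessel_def phi11_reg_commute[of b]
    by (intro has_sum_divide_const phi11_reg_has_sum)
  moreover have "Q powi (k + 1) * Q ^ j = Q powi (k + int j + 1)" for j
    using Q_powi_add[of "k + 1" "int j"] by (simp add: add_ac)
  ultimately show ?thesis by (simp add: rfact_def mult_ac)
qed

text \<open>As \<open>k\<close> tends to minus infinity the argument \<open>Q powi (k + 1)\<close>
  is unbounded. In the exchanged series \<open>k\<close> occurs only in the bounded
  \<open>rfact\<close>, so one bound serves all \<open>k\<close>.\<close>

lemma qbessel_bounded: "\<exists>M. \<forall>k. norm (qbessel k b) \<le> M"
proof -
  obtain K where K: "\<And>n. norm (rfact n) \<le> K" using rfact_bounded by blast
  have "norm (qbessel k b) \<le> (\<Sum>\<^sub>\<infinity>j. K * norm (euler_coeff j * b ^ j))" for k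
  proof (rule norm_infsum_le[OF qbessel_has_sum])
    show "((\<lambda>j. K * norm (euler_coeff j * b ^ j))
      has_sum (\<Sum>\<^sub>\<infinity>j. K * norm (euler_coeff j * b ^ j))) UNIV"
      by (intro has_sum_infsum summable_on_cmult_right euler_coeff_abs_summable)
    show "norm (euler_coeff j * b ^ j * rfact (k + int j)) \<le> K * norm (euler_coeff j * b ^ j)" for j
      using mult_right_mono[OF K[of "k + int j"], of "norm (euler_coeff j * b ^ j)"]
      by (simp add: norm_mult mult_ac)
  qed
  then show ?thesis by blast
qed


text \<open>All factors of \<open>qpoch Q q i\<close> are positive, so \<open>euler_coeff i\<close>
  has sign \<open>(-1) ^ i\<close>. The series of norms is therefore Euler's series at
  \<open>- norm z\<close>, which gives the majorant in closed form.\<close>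

lemma norm_euler_coeff_power: "complex_of_real (norm (euler_coeff i * z ^ i))
  = euler_coeff i * (- complex_of_real (norm z)) ^ i"
proof -
  define r where "r = (\<Prod>j<i. 1 - q * q ^ j)"
  have "r > 0" unfolding r_def
  proof (rule prod_pos)
    fix j
    show "0 < 1 - q * q ^ j"
      using q_pos q_less_1 power_Suc_less_one[of q j] by simp
  qed
  moreover have "qpoch Q q i = complex_of_real r"
    by (simp add: qpoch_def r_def)
  ultimately have coeff_eq:
      "euler_coeff i = (-1) ^ i * complex_of_real (q ^ (i * (i - 1) div 2) / r)"
    and pos: "q ^ (i * (i - 1) div 2) / r > 0"
    using q_pos by (simp_all add: euler_coeff_def)
  have "norm (euler_coeff i) = q ^ (i * (i - 1) div 2) / r"
    unfolding coeff_eq norm_mult norm_of_real abs_of_pos[OF pos] by (simp add: norm_power)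
  moreover have "(- complex_of_real (norm z)) ^ i = (-1) ^ i * complex_of_real (norm z ^ i)"
    by (subst power_minus) simp
  moreover have "(-1) ^ i * (-1) ^ i = (1 :: complex)"
    by (simp flip: power_mult_distrib)
  ultimately show ?thesis
    unfolding norm_mult norm_power of_real_mult by (simp add: coeff_eq)
qed

lemma infsum_norm_euler_coeff: "(\<Sum>\<^sub>\<infinity>i. norm (euler_coeff i * z ^ i))
  = norm (qpoch_inf (- complex_of_real (norm z)) q)"
proof -
  have "((\<lambda>i. norm (euler_coeff i * z ^ i)) has_sum (\<Sum>\<^sub>\<infinity>i. norm (euler_coeff i * z ^ i))) UNIV"
    by (intro has_sum_infsum euler_coeff_abs_summable)
  then have "((\<lambda>i. complex_of_real (norm (euler_coeff i * z ^ i)))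
      has_sum complex_of_real (\<Sum>\<^sub>\<infinity>i. norm (euler_coeff i * z ^ i))) UNIV"
    by (rule has_sum_of_real)
  then have "complex_of_real (\<Sum>\<^sub>\<infinity>i. norm (euler_coeff i * z ^ i))
    = qpoch_inf (- complex_of_real (norm z)) q"
    unfolding norm_euler_coeff_power using euler_has_sum has_sum_unique by blast
  then have "norm (complex_of_real (\<Sum>\<^sub>\<infinity>i. norm (euler_coeff i * z ^ i)))
    = norm (qpoch_inf (- complex_of_real (norm z)) q)"
    by simp
  moreover have "(\<Sum>\<^sub>\<infinity>i. norm (euler_coeff i * z ^ i)) \<ge> 0" by (rule infsum_nonneg) simp
  ultimately show ?thesis by simp
qed

lemma
  assumes "norm t < 1"
  shows rfact_has_sum: "((\<lambda>n. t powi n * rfact n) has_sum (1 / qpoch_inf t q)) UNIV"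
    and rfact_abs_summable: "(\<lambda>n. norm (t powi n * rfact n)) summable_on UNIV"
proof -
  show "((\<lambda>n. t powi n * rfact n) has_sum (1 / qpoch_inf t q)) UNIV"
    using norm_summable_imp_has_sum[OF summable_norm_inverse_euler inverse_euler_sums, OF assms
      assms]
    by (intro has_sum_int_nat) (auto simp: rfact_neg rfact_of_nat)
  have "(\<lambda>i. norm (t ^ i / qpoch Q q i)) summable_on UNIV"
    using summable_norm_inverse_euler[OF assms] by (subst summable_on_UNIV_nonneg_real_iff) auto
  then obtain S where "((\<lambda>i. norm (t ^ i / qpoch Q q i)) has_sum S) UNIV"
    by (auto simp: summable_on_def)
  then have "((\<lambda>n. norm (t powi n * rfact n)) has_sum S) UNIV"
    by (intro has_sum_int_nat) (auto simp: rfact_neg rfact_of_nat)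
  then show "(\<lambda>n. norm (t powi n * rfact n)) summable_on UNIV"
    by (auto simp: summable_on_def)
qed

text \<open>Writing \<open>t powi k\<close> as \<open>t powi (k + int j)\<close> divided by
  \<open>t ^ j\<close> makes \<open>t powi k * qbessel k b\<close> the convolution coefficient of
  the two Euler series, for \<open>1 / (t;q)_\<infinity>\<close> and for
  \<open>(b / t;q)_\<infinity>\<close>.\<close>

lemma
  assumes t: "t \<noteq> 0" "norm t < 1"
  shows qbessel_generating: "((\<lambda>k. t powi k * qbessel k b)
    has_sum (qpoch_inf (b / t) q / qpoch_inf t q)) UNIV"
    and qbessel_abs_summable: "(\<lambda>k. norm (t powi k * qbessel k b)) summable_on UNIV"
    and qbessel_norm_le: "(\<Sum>\<^sub>\<infinity>k. norm (t powi k * qbessel k b))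
      \<le> (\<Sum>\<^sub>\<infinity>n. norm (t powi n * rfact n)) * norm (qpoch_inf (- complex_of_real (norm (b / t))) q)"
proof -
  have g: "((\<lambda>j. (t powi (k + int j) * rfact (k + int j)) * (euler_coeff j * (b / t) ^ j))
    has_sum (t powi k * qbessel k b)) UNIV"
    for k
  proof -
    have "t powi k * (euler_coeff j * b ^ j * rfact (k + int j))
        = (t powi (k + int j) * rfact (k + int j)) * (euler_coeff j * (b / t) ^ j)" for j
      using t(1) by (simp add: power_int_add power_divide)
    with has_sum_cmult_right[OF qbessel_has_sum[of b k], of "t powi k"] show ?thesis by simp
  qed
  note L = laurent_product_has_sum laurent_product_abs_summable laurent_product_norm_le
  note L = L[OF rfact_abs_summable[OF t(2)] euler_coeff_abs_summable g]
  show "((\<lambda>k. t powi k * qbessel k b) has_sum (qpoch_inf (b / t) q / qpoch_inf t q)) UNIV"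
    using L(1) infsumI[OF rfact_has_sum[OF t(2)]] infsumI[OF euler_has_sum[of "b / t"]] by simp
  show "(\<lambda>k. norm (t powi k * qbessel k b)) summable_on UNIV" by (rule L(2))
  show "(\<Sum>\<^sub>\<infinity>k. norm (t powi k * qbessel k b))
      \<le> (\<Sum>\<^sub>\<infinity>n. norm (t powi n * rfact n)) * norm (qpoch_inf (- complex_of_real (norm (b / t))) q)"
    using L(3) unfolding infsum_norm_euler_coeff .
qed

lemma qbessel_qdiff:
  "qbessel (k - 1) b + b / Q * qbessel (k + 1) b = (1 + b / Q - Q powi k) * qbessel k b"
proof -
  have e: "Q powi (k + 1) = Q powi k * Q" "Q powi (k + 1 + 1) = Q powi k * Q\<^sup>2"
    by (simp_all add: Q_powi_add power2_eq_square)
  have "qbessel (k - 1) b + b / Q * qbessel (k + 1) b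
      = (phi11_reg b (Q powi k) + b / Q * phi11_reg b (Q powi k * Q\<^sup>2)) / qpoch_inf Q q"
    unfolding qbessel_def e by (simp add: add_divide_distrib)
  also have "phi11_reg b (Q powi k) + b / Q * phi11_reg b (Q powi k * Q\<^sup>2)
      = (1 + b / Q - Q powi k) * phi11_reg b (Q powi k * Q)"
    using phi11_reg_qdiff[of b "Q powi k"] by simp
  finally show ?thesis
    unfolding qbessel_def e by simp
qed

section \<open>The bilateral product sum\<close>

text \<open>Up to elementary factors the stated sum depends on \<open>n\<close> and \<open>m\<close>
  only through \<open>d = n - m\<close>; the intended values are \<open>p = s * x * y\<close>,
  \<open>b = x\<^sup>2\<close>, \<open>c = y\<^sup>2\<close>.\<close>

definition qbessel_prod :: "complex \<Rightarrow> complex \<Rightarrow> complex \<Rightarrow> int \<Rightarrow> complex" where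
  "qbessel_prod p b c d = (\<Sum>\<^sub>\<infinity>k. p powi k * qbessel (k + d) c * qbessel k b)"

text \<open>The first factor is bounded, and the second is absolutely summable against the powers of
  \<open>p\<close> by \<open>qbessel_abs_summable\<close>.\<close>

lemma product_summable:
  assumes p: "p \<noteq> 0" "norm p < 1"
  shows "(\<lambda>k. p powi k * qbessel (k + d) c * qbessel (k + e) b) summable_on UNIV"
proof (rule abs_summable_summable)
  obtain M where M: "\<And>k. norm (qbessel k c) \<le> M" using qbessel_bounded by blast
  have "(\<lambda>k. norm (p powi k * qbessel k b)) summable_on UNIV" by (rule qbessel_abs_summable[OF p])
  then have "(\<lambda>k. norm (p powi (k + e) * qbessel (k + e) b)) summable_on UNIV"
    using summable_on_reindex_bij_betw[of "\<lambda>k. k + e" UNIV UNIV "\<lambda>k. norm (p powi k * qbessel k b)"]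
    by (simp add: bij_plus_right)
  then have "(\<lambda>k. M * norm (p powi (- e)) * norm (p powi (k + e) * qbessel (k + e) b))
    summable_on UNIV"
    by (rule summable_on_cmult_right)
  then show "(\<lambda>k. norm (p powi k * qbessel (k + d) c * qbessel (k + e) b)) summable_on UNIV"
  proof (rule Infinite_Sum.abs_summable_on_comparison_test')
    fix k
    have "p powi k = p powi (- e) * p powi (k + e)"
      using p by (simp flip: power_int_add)
    then have "norm (p powi k * qbessel (k + d) c * qbessel (k + e) b)
        = norm (qbessel (k + d) c) * (norm (p powi (- e))
          * norm (p powi (k + e) * qbessel (k + e) b))"
      by (simp add: norm_mult mult_ac)
    also have "\<dots> \<le> M * (norm (p powi (- e)) * norm (p powi (k + e) * qbessel (k + e) b))"
      by (intro mult_right_mono M) auto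
    finally show "norm (p powi k * qbessel (k + d) c * qbessel (k + e) b)
      \<le> M * norm (p powi (- e)) * norm (p powi (k + e) * qbessel (k + e) b)"
      by (simp add: mult_ac)
  qed
qed

text \<open>A change of the summation index moves the shift \<open>e\<close> of the second factor
  into \<open>d\<close>, at the price of \<open>p powi (- e)\<close>.\<close>

lemma qbessel_prod_has_sum:
  assumes p: "p \<noteq> 0" "norm p < 1"
  shows "((\<lambda>k. p powi k * qbessel (k + d) c * qbessel (k + e) b)
    has_sum (p powi (- e) * qbessel_prod p b c (d - e))) UNIV"
proof -
  have "((\<lambda>k. p powi k * qbessel (k + (d - e)) c * qbessel k b)
    has_sum qbessel_prod p b c (d - e)) UNIV"
    unfolding qbessel_prod_def using product_summable[OF p, of "d - e" c 0 b] by simp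
  then have "((\<lambda>k. p powi (k + e) * qbessel (k + e + (d - e)) c * qbessel (k + e) b)
    has_sum qbessel_prod p b c (d - e)) UNIV"
    using has_sum_reindex_bij_betw[of "\<lambda>k. k + e" UNIV UNIV
      "\<lambda>k. p powi k * qbessel (k + (d - e)) c * qbessel k b"]
    by (simp add: bij_plus_right)
  from has_sum_cmult_right[OF this, of "p powi (- e)"] show ?thesis
    using p by (simp add: power_int_add power_int_minus field_simps)
qed

text \<open>Both sides evaluate the sum over \<open>k\<close> of
  \<open>p powi k * Q powi (k + d) * qbessel (k + d) c * qbessel k b\<close>, using the three-term
  recurrence in the first or in the second factor.\<close>

lemma qbessel_prod_qdiff:
  assumes p: "p \<noteq> 0" "norm p < 1"
  shows "(1 + c / Q) * qbessel_prod p b c d - qbessel_prod p b c (d - 1)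
      - c / Q * qbessel_prod p b c (d + 1)
    = Q powi d * ((1 + b / Q) * qbessel_prod p b c d
      - p * qbessel_prod p b c (d + 1) - b / (Q * p) * qbessel_prod p b c (d - 1))"
proof -
  define f where "f d e k = p powi k * qbessel (k + d) c * qbessel (k + e) b" for d e k
  have f: "(f d e has_sum (p powi (- e) * qbessel_prod p b c (d - e))) UNIV" for d e
    unfolding f_def by (rule qbessel_prod_has_sum[OF p])
  have 1: "((\<lambda>k. (1 + c / Q) * f d 0 k - f (d - 1) 0 k - c / Q * f (d + 1) 0 k)
      has_sum ((1 + c / Q) * qbessel_prod p b c d - qbessel_prod p b c (d - 1)
        - c / Q * qbessel_prod p b c (d + 1))) UNIV"
    by (intro has_sum_sub has_sum_cmult_right) (use f[of _ 0] in auto)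
  \<comment> \<open>The shifts \<open>e = -1\<close> and \<open>e = 1\<close> produce the values at
    \<open>d + 1\<close> and \<open>d - 1\<close>, with weights \<open>p\<close> and
    \<open>inverse p\<close>.\<close>
  have 2: "((\<lambda>k. Q powi d * ((1 + b / Q) * f d 0 k - f d (- 1) k - b / Q * f d 1 k))
      has_sum (Q powi d * ((1 + b / Q) * qbessel_prod p b c d
        - p * qbessel_prod p b c (d + 1) - b / Q * (inverse p * qbessel_prod p b c (d - 1))))) UNIV"
    by (intro has_sum_sub has_sum_cmult_right)
      (use f[of d 0] f[of d "- 1"] f[of d 1] in \<open>auto simp: power_int_minus\<close>)
  have "(1 + c / Q) * f d 0 k - f (d - 1) 0 k - c / Q * f (d + 1) 0 k
      = Q powi d * ((1 + b / Q) * f d 0 k - f d (- 1) k - b / Q * f d 1 k)" for k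
  proof -
    have "(1 + c / Q) * qbessel (k + d) c - qbessel (k + d - 1) c - c / Q * qbessel (k + d + 1) c
      = Q powi (k + d) * qbessel (k + d) c"
      using qbessel_qdiff[of "k + d" c] by (simp add: algebra_simps)
    moreover have "(1 + b / Q) * qbessel k b - qbessel (k - 1) b - b / Q * qbessel (k + 1) b
      = Q powi k * qbessel k b"
      using qbessel_qdiff[of k b] by (simp add: algebra_simps)
    moreover have "(1 + c / Q) * f d 0 k - f (d - 1) 0 k - c / Q * f (d + 1) 0 k
      = p powi k * qbessel k b * ((1 + c / Q) * qbessel (k + d) c
        - qbessel (k + d - 1) c - c / Q * qbessel (k + d + 1) c)"
      unfolding f_def by (simp add: algebra_simps)
    moreover have "(1 + b / Q) * f d 0 k - f d (- 1) k - b / Q * f d 1 k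
      = p powi k * qbessel (k + d) c * ((1 + b / Q) * qbessel k b - qbessel (k - 1) b
        - b / Q * qbessel (k + 1) b)"
      unfolding f_def by (simp add: algebra_simps)
    ultimately show ?thesis by (simp add: Q_powi_add)
  qed
  then have "(1 + c / Q) * qbessel_prod p b c d - qbessel_prod p b c (d - 1)
      - c / Q * qbessel_prod p b c (d + 1)
    = Q powi d * ((1 + b / Q) * qbessel_prod p b c d
      - p * qbessel_prod p b c (d + 1) - b / Q * (inverse p * qbessel_prod p b c (d - 1)))"
    by (intro has_sum_unique[OF 1]) (simp only: 2)
  then show ?thesis by (simp add: field_simps)
qed

section \<open>Analytic continuation of \<open>2\<phi>1\<close>\<close>

text \<open>The set is the zero set of the entire function \<open>euler_fun\<close>.\<close>

lemma closed_nonpos_qpowers: "closed (nonpos_qpowers q)"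
proof -
  have "euler_fun holomorphic_on ball 0 r" for r
    by (rule power_series_holomorphic[where a = euler_coeff])
      (use euler_sums in \<open>simp add: qpoch_inf_eq\<close>)
  then have "continuous (at z) euler_fun" for z
    by (metis holomorphic_on_imp_continuous_on continuous_on_eq_continuous_at open_ball
        centre_in_ball dist_0_norm gt_ex mem_ball)
  then have "closed {z. euler_fun z = 0}"
    by (intro closed_Collect_eq continuous_at_imp_continuous_on) auto
  moreover have "{z. euler_fun z = 0} = nonpos_qpowers q"
    using qpoch_inf_nonzero qpoch_inf_eq_0 unfolding qpoch_inf_eq by blast
  ultimately show ?thesis by simp
qed

lemma connected_compl_nonpos_qpowers: "connected (- nonpos_qpowers q)"
  by (intro path_connected_imp_connected path_connected_complement_countable)
    (auto simp: nonpos_qpowers_def)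

text \<open>Solving the equation for \<open>F z\<close> expresses it by values at
  \<open>z * Q\<close> and \<open>z * Q\<^sup>2\<close>, which lie closer to 0, so each use enlarges
  the disc by the factor \<open>1 / q\<close>. Division by \<open>1 - z\<close> excludes the point 1
  and, on iteration, all of \<open>nonpos_qpowers q\<close>.\<close>

lemma qdiff_continuation:
  fixes F \<alpha> \<beta> :: "complex \<Rightarrow> complex"
  assumes F: "F holomorphic_on ball 0 1"
    and \<alpha>: "\<alpha> holomorphic_on UNIV" and \<beta>: "\<beta> holomorphic_on UNIV"
    and eq: "\<And>z. norm z < 1 \<Longrightarrow> (1 - z) * F z = \<alpha> z * F (z * Q) + \<beta> z * F (z * Q\<^sup>2)"
  obtains F' where "F' holomorphic_on - nonpos_qpowers q"
    and "\<And>z. norm z < 1 \<Longrightarrow> F' z = F z"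
    and "\<And>z. z \<notin> nonpos_qpowers q \<Longrightarrow>
      (1 - z) * F' z = \<alpha> z * F' (z * Q) + \<beta> z * F' (z * Q\<^sup>2)"
proof -
  define step where "step g z = (\<alpha> z * g (z * Q) + \<beta> z * g (z * Q\<^sup>2)) / (1 - z)"
    for g :: "complex \<Rightarrow> complex" and z
  define P where "P N = (step ^^ N) F" for N
  have P_0: "P 0 = F" and P_Suc: "P (Suc N) = step (P N)" for N
    by (simp_all add: P_def)
  define D where "D N = ball 0 (1 / q ^ N) - nonpos_qpowers q" for N
  have norm_mult_Q: "norm (z * Q) \<le> norm z" for z
    using mult_left_mono[OF norm_Q_power_le_1[of 1], of "norm z"] by (simp add: norm_mult)
  have not1: "z \<noteq> 1" if "z \<notin> nonpos_qpowers q" for z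
    using that unfolding nonpos_qpowers_iff by (metis mult_1 power_0)
  have D_Q: "z * Q \<in> D N" if "z \<in> D (Suc N)" for z N
    using that q_pos mult_Q_notin_nonpos_qpowers[of z]
    by (auto simp: D_def norm_mult norm_Q field_simps)
  have D_mult: "z * Q \<in> D N" if "z \<in> D N" for z N
    using that norm_mult_Q[of z] mult_Q_notin_nonpos_qpowers[of z] by (auto simp: D_def)
  have D_Q2: "z * Q\<^sup>2 \<in> D N" if "z \<in> D (Suc N)" for z N
    using D_mult[OF D_Q[OF that]] by (simp add: power2_eq_square mult.assoc)
  have open_D: "open (D N)" for N
    unfolding D_def by (intro open_Diff closed_nonpos_qpowers open_ball)
  have hol: "P N holomorphic_on D N" for N
  proof (induction N)
    case 0
    show ?case unfolding P_0 by (rule holomorphic_on_subset[OF F]) (auto simp: D_def)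
  next
    case (Suc N)
    have 1: "(\<lambda>z. P N (z * r)) holomorphic_on D (Suc N)" if "\<And>z. z \<in> D (Suc N) \<Longrightarrow> z * r \<in> D N" for r
      by (rule holomorphic_on_compose_gen[unfolded o_def, OF _ Suc])
        (use that in \<open>auto intro!: holomorphic_intros\<close>)
    show ?case unfolding P_Suc step_def
      by (intro holomorphic_intros 1 D_Q D_Q2 holomorphic_on_subset[OF \<alpha>] holomorphic_on_subset
        [OF \<beta>])
        (use not1 in \<open>auto simp: D_def\<close>)
  qed
  \<comment> \<open>On the domain already reached a further step changes nothing: at the start this
    is \<open>eq\<close>, and afterwards it is inherited from \<open>z * Q\<close> and
    \<open>z * Q\<^sup>2\<close>.\<close>
  have stable: "P (Suc N) z = P N z" if "z \<in> D N" for N z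
    using that
  proof (induction N arbitrary: z)
    case 0
    then show ?case using eq[of z] not1[of z] by (simp add: P_Suc P_0 step_def D_def field_simps)
  next
    case (Suc N)
    have "P (Suc (Suc N)) z = step (P (Suc N)) z" by (simp add: P_Suc)
    also have "\<dots> = step (P N) z"
      unfolding step_def using Suc.IH[OF D_Q] Suc.IH[OF D_Q2] Suc.prems by simp
    finally show ?case by (simp add: P_Suc)
  qed
  have D_mono: "z \<in> D (N + m)" if "z \<in> D N" for z N m
  proof -
    have "q ^ (N + m) \<le> q ^ N" using q_pos q_less_1 by (simp add: power_decreasing)
    then have "1 / q ^ N \<le> 1 / q ^ (N + m)" using q_pos by (intro divide_left_mono) auto
    then show ?thesis using that by (auto simp: D_def)
  qed
  have stable': "P (N + m) z = P N z" if "z \<in> D N" for N m z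
    by (induction m) (use stable D_mono that in auto)
  have D_ex: "\<exists>N. z \<in> D N" if "z \<notin> nonpos_qpowers q" for z
  proof -
    have pos: "norm z + 1 > 0" by (simp add: add_nonneg_pos)
    then obtain N where N: "q ^ N < inverse (norm z + 1)"
      using real_arch_pow_inv[of "inverse (norm z + 1)" q] q_less_1 by auto
    have "q ^ N * (norm z + 1) < inverse (norm z + 1) * (norm z + 1)"
      by (rule mult_strict_right_mono[OF N pos])
    then have "norm z + 1 < 1 / q ^ N"
      using q_pos pos by (simp add: field_simps)
    then show ?thesis using that by (auto simp: D_def intro!: exI[of _ N])
  qed
  \<comment> \<open>By \<open>stable'\<close> every \<open>N\<close> with \<open>z \<in> D N\<close>
    gives the same value; the least one is merely a choice.\<close>
  define F' where "F' z = P (LEAST N. z \<in> D N) z" for z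
  have F': "F' z = P N z" if "z \<in> D N" for z N
  proof -
    have "z \<in> D (LEAST N. z \<in> D N)" "(LEAST N. z \<in> D N) \<le> N"
      using that by (auto intro: LeastI Least_le)
    then show ?thesis
      unfolding F'_def by (metis stable' le_add_diff_inverse)
  qed
  have "F' holomorphic_on (\<Union>N. D N)"
  proof (rule holomorphic_on_UN_open)
    show "F' holomorphic_on D N" for N
      by (rule holomorphic_transform[OF hol]) (simp add: F')
  qed (rule open_D)
  moreover have "(\<Union>N. D N) = - nonpos_qpowers q"
    using D_ex by (auto simp: D_def)
  moreover have "F' z = F z" if "norm z < 1" for z
    using F'[of z 0] that nonpos_qpowers_norm[of z] by (auto simp: D_def P_0)
  moreover have "(1 - z) * F' z = \<alpha> z * F' (z * Q) + \<beta> z * F' (z * Q\<^sup>2)"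
    if z: "z \<notin> nonpos_qpowers q" for z
  proof -
    obtain N where N: "z \<in> D N" using D_ex[OF z] by blast
    have "F' z = step (P N) z"
      using F'[OF N] stable[OF N] by (simp add: P_Suc)
    moreover have "F' (z * Q) = P N (z * Q)" "F' (z * Q\<^sup>2) = P N (z * Q\<^sup>2)"
      using F'[OF D_mult[OF N]] F'[OF D_mult[OF D_mult[OF N]]]
      by (simp_all add: power2_eq_square mult.assoc)
    ultimately show ?thesis using not1[OF z] by (simp add: step_def)
  qed
  ultimately show ?thesis using that by simp
qed

section \<open>The \<open>q\<close>-difference equation of 2phi1, first for the series and then for
  its continuation\<close>

definition phi21_coeff :: "complex \<Rightarrow> complex \<Rightarrow> complex \<Rightarrow> nat \<Rightarrow> complex" where
  "phi21_coeff a b c k = qpoch a q k * qpoch b q k / (qpoch c q k * qpoch Q q k)"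

lemma phi21_series_eq: "phi21_series a b c q z = (\<Sum>k. phi21_coeff a b c k * z ^ k)"
  by (simp add: phi21_series_def phi21_coeff_def)

text \<open>The coefficients converge to a quotient of infinite products, hence are bounded, and a
  geometric series dominates.\<close>

lemma phi21_summable:
  assumes c: "c \<notin> nonpos_qpowers q" and z: "norm z < 1"
  shows "summable (\<lambda>k. phi21_coeff a b c k * z ^ k)"
proof (rule summable_norm_cancel)
  have "(\<lambda>k. phi21_coeff a b c k) \<longlonglongrightarrow>
      qpoch_inf a q * qpoch_inf b q / (qpoch_inf c q * qpoch_inf Q q)"
    unfolding phi21_coeff_def
    by (intro tendsto_intros qpoch_LIMSEQ) (use qpoch_inf_nonzero[OF c] in simp)
  then obtain K where K: "\<And>k. norm (phi21_coeff a b c k) \<le> K"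
    using convergentI convergent_imp_Bseq BseqE by metis
  show "summable (\<lambda>k. norm (phi21_coeff a b c k * z ^ k))"
  proof (rule summable_comparison_test'[where N = 0])
    show "summable (\<lambda>k. K * norm z ^ k)"
      using z by (intro summable_mult summable_geometric) simp
    show "norm (norm (phi21_coeff a b c k * z ^ k)) \<le> K * norm z ^ k" for k
      using mult_right_mono[OF K[of k], of "norm z ^ k"] by (simp add: norm_mult norm_power)
  qed
qed

lemma phi21_coeff_Suc:
  assumes c: "c \<notin> nonpos_qpowers q"
  shows "phi21_coeff a b c (Suc k) * ((1 - c * Q ^ k) * (1 - Q ^ Suc k))
    = phi21_coeff a b c k * ((1 - a * Q ^ k) * (1 - b * Q ^ k))"
proof -
  have "1 - c * Q ^ k \<noteq> 0" "1 - Q ^ Suc k \<noteq> 0"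
    using qpoch_nonzero[OF c, of "Suc k"] one_minus_Q_power_nonzero by (auto simp: qpoch_Suc)
  moreover have "x * r * (y * s) / ((z * t) * (w * v)) * (t * v) = x * y / (z * w) * (r * s)"
    if "t \<noteq> 0" "v \<noteq> 0" for x y z w r s t v :: complex
    using that by simp
  ultimately show ?thesis
    unfolding phi21_coeff_def qpoch_Suc power_Suc by blast
qed

text \<open>The ratio of consecutive coefficients is a quotient of two quadratics in
  \<open>Q ^ k\<close>, so \<open>powser_qdiff\<close> applies.\<close>

lemma phi21_series_qdiff:
  assumes c: "c \<notin> nonpos_qpowers q" and z: "norm z < 1"
  shows "(1 - z) * phi21_series a b c q z
    = (1 + c / Q - (a + b) * z) * phi21_series a b c q (z * Q)
      + (a * b * z - c / Q) * phi21_series a b c q (z * Q\<^sup>2)"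
proof -
  have zQ: "norm (z * Q ^ i) < 1" for i
    using mult_left_mono[OF norm_Q_power_le_1[of i], of "norm z"] z by (simp add: norm_mult)
  have rec: "phi21_coeff a b c (Suc k) * (1 + (- (1 + c / Q)) * Q ^ Suc k + c / Q * (Q ^ Suc k)\<^sup>2)
      = phi21_coeff a b c k * (1 + (- (a + b)) * Q ^ k + (a * b) * (Q ^ k)\<^sup>2)" for k
  proof -
    have "1 + (- (1 + c / Q)) * Q ^ Suc k + c / Q * (Q ^ Suc k)\<^sup>2
      = (1 - c * Q ^ k) * (1 - Q ^ Suc k)"
      using Q_nonzero by (simp add: field_simps power2_eq_square del: of_real_eq_0_iff Q_nonzero)
    moreover have "1 + (- (a + b)) * Q ^ k + (a * b) * (Q ^ k)\<^sup>2 = (1 - a * Q ^ k) * (1 - b * Q ^ k)"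
      by (simp add: algebra_simps power2_eq_square)
    ultimately show ?thesis using phi21_coeff_Suc[OF c] by simp
  qed
  have "1 * phi21_series a b c q z + (- (1 + c / Q)) * phi21_series a b c q (z * Q)
        + c / Q * phi21_series a b c q (z * Q\<^sup>2)
      = z * (1 * phi21_series a b c q z + (- (a + b)) * phi21_series a b c q (z * Q)
        + (a * b) * phi21_series a b c q (z * Q\<^sup>2))"
    unfolding phi21_series_eq
    by (rule powser_qdiff[OF _ _ _ rec])
      (use phi21_summable[OF c] z zQ[of 1] zQ[of 2] in auto)
  then show ?thesis by (simp add: algebra_simps)
qed

text \<open>The description in \<open>phi21\<close> is resolved here: existence comes from
  \<open>qdiff_continuation\<close>, uniqueness from the identity theorem on the connected open
  complement of \<open>nonpos_qpowers q\<close>. So \<open>phi21\<close> agrees there with the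
  continuation and inherits its equation.\<close>

lemma phi21_qdiff:
  assumes c: "c \<notin> nonpos_qpowers q" and z: "z \<notin> nonpos_qpowers q"
  shows "(1 - z) * phi21 a b c q z
    = (1 + c / Q - (a + b) * z) * phi21 a b c q (z * Q)
      + (a * b * z - c / Q) * phi21 a b c q (z * Q\<^sup>2)"
proof -
  have hol: "phi21_series a b c q holomorphic_on ball 0 1"
    by (rule power_series_holomorphic[where a = "phi21_coeff a b c"])
      (use phi21_summable[OF c] in \<open>auto simp: phi21_series_eq intro!: summable_sums\<close>)
  obtain F where F: "F holomorphic_on - nonpos_qpowers q"
      "\<And>z. norm z < 1 \<Longrightarrow> F z = phi21_series a b c q z"
      "\<And>z. z \<notin> nonpos_qpowers q \<Longrightarrow>
        (1 - z) * F z = (1 + c / Q - (a + b) * z) * F (z * Q) + (a * b * z - c / Q) * F (z * Q\<^sup>2)"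
    by (rule qdiff_continuation[OF hol _ _ phi21_series_qdiff[OF c]])
      (use Q_nonzero in \<open>auto intro!: holomorphic_intros\<close>)
  have unique: "F\<^sub>2 z = F z" if F\<^sub>2: "F\<^sub>2 holomorphic_on - nonpos_qpowers q"
      "\<forall>u. norm u < 1 \<longrightarrow> F\<^sub>2 u = phi21_series a b c q u" and "z \<notin> nonpos_qpowers q" for F\<^sub>2 z
  proof (rule analytic_continuation_open[where s = "ball 0 1" and s' = "- nonpos_qpowers q"
      and f = F\<^sub>2 and g = F])
    show "open (- nonpos_qpowers q)" using closed_nonpos_qpowers by auto
    show "ball 0 1 \<subseteq> - nonpos_qpowers q" using nonpos_qpowers_norm by fastforce
    show "connected (- nonpos_qpowers q)" by (rule connected_compl_nonpos_qpowers)
  qed (use that F in auto)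
  have "phi21 a b c q z = F z" if "z \<notin> nonpos_qpowers q" for z
  proof (cases "norm z < 1")
    case False
    have "(THE v. \<exists>F. F holomorphic_on (- nonpos_qpowers q) \<and>
        (\<forall>u. norm u < 1 \<longrightarrow> F u = phi21_series a b c q u) \<and> F z = v) = F z"
      by (rule the_equality) (use F unique that in blast)+
    then show ?thesis using False by (simp add: phi21_def)
  qed (simp add: phi21_def F)
  moreover have "z * Q \<notin> nonpos_qpowers q" "z * Q\<^sup>2 \<notin> nonpos_qpowers q"
    using mult_Q_notin_nonpos_qpowers[OF z] mult_Q_notin_nonpos_qpowers
      [OF mult_Q_notin_nonpos_qpowers[OF z]]
    by (simp_all add: power2_eq_square mult.assoc)
  ultimately show ?thesis using F(3)[OF z] z by simp
qed

section \<open>Evaluation of the product sum\<close>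

text \<open>Each factor \<open>1 - u / Q ^ i\<close> with \<open>1 \<le> i \<le> j\<close> equals
  \<open>- (u / Q ^ i) * (1 - Q ^ i / u)\<close>; the prefactor on the left cancels the signs and
  powers of \<open>Q\<close>. This is the source of the parameter \<open>Q / u\<close>.\<close>

lemma qpoch_reflect:
  assumes "u \<noteq> 0"
  shows "(-1) ^ j * Q ^ (j * (j - 1) div 2) * Q ^ j * qpoch (u / Q ^ j) q j
    = u ^ j * qpoch (Q / u) q j"
proof (induction j)
  case (Suc j)
  have "qpoch (u / Q ^ Suc j) q (Suc j) = (1 - u / Q ^ Suc j) * qpoch (u / Q ^ j) q j"
    unfolding qpoch_Suc_left using Q_nonzero by simp
  then have "(-1) ^ Suc j * Q ^ (Suc j * (Suc j - 1) div 2) * Q ^ Suc j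
      * qpoch (u / Q ^ Suc j) q (Suc j)
      = ((-1) ^ j * Q ^ (j * (j - 1) div 2) * Q ^ j * qpoch (u / Q ^ j) q j) * (u - Q ^ Suc j)"
  proof -
    have "- (Q ^ Suc j * (1 - u / Q ^ Suc j)) = u - Q ^ Suc j"
      using Q_nonzero by (simp add: right_diff_distrib del: of_real_eq_0_iff Q_nonzero)
    then have "((-1) ^ j * Q ^ (j * (j - 1) div 2) * Q ^ j * qpoch (u / Q ^ j) q j)
        * (u - Q ^ Suc j)
      = ((-1) ^ j * Q ^ (j * (j - 1) div 2) * Q ^ j * qpoch (u / Q ^ j) q j)
        * (- (Q ^ Suc j * (1 - u / Q ^ Suc j)))"
      by simp
    then show ?thesis
      unfolding triangle_Suc power_add \<open>qpoch (u / Q ^ Suc j) q (Suc j) = _\<close>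
      by (simp add: mult_ac)
  qed
  also have "\<dots> = u ^ j * qpoch (Q / u) q j * (u - Q ^ Suc j)"
    unfolding Suc by simp
  also have "\<dots> = u ^ Suc j * qpoch (Q / u) q (Suc j)"
    unfolding qpoch_Suc using assms by (simp add: field_simps)
  finally show ?case .
qed simp

text \<open>The quadratic decay of \<open>euler_coeff\<close> cancels the quadratic growth of the
  product at \<open>u / Q ^ j\<close>; the norms of consecutive terms are related by a factor
  tending to \<open>norm (v * u / Q)\<close>.\<close>

lemma summable_euler_coeff_qpoch_inf:
  assumes "norm (v * u / Q) < 1"
  shows "summable (\<lambda>j. norm (euler_coeff j * v ^ j * qpoch_inf (u / Q ^ j) q))"
proof (rule summable_norm_ratio_limit)
  have "(\<lambda>j. norm (v * (Q ^ j - u / Q) / (1 - Q ^ Suc j))) \<longlonglongrightarrow> norm (v * (0 - u / Q) / (1 - 0))"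
    by (intro tendsto_intros Q_power_LIMSEQ LIMSEQ_Suc[OF Q_power_LIMSEQ]) auto
  then show "(\<lambda>j. norm (v * (Q ^ j - u / Q) / (1 - Q ^ Suc j))) \<longlonglongrightarrow> norm (v * u / Q)"
    by simp
  show "norm (euler_coeff (Suc j) * v ^ Suc j * qpoch_inf (u / Q ^ Suc j) q)
      \<le> norm (v * (Q ^ j - u / Q) / (1 - Q ^ Suc j)) * norm (euler_coeff j * v ^ j
        * qpoch_inf (u / Q ^ j) q)" for j
  proof -
    have "qpoch_inf (u / Q ^ Suc j) q = (1 - u / Q ^ Suc j) * qpoch_inf (u / Q ^ j) q"
      using qpoch_inf_split[of "u / Q ^ Suc j" 1] Q_nonzero by (simp add: qpoch_Suc)
    moreover have "Q ^ j * (1 - u / Q ^ Suc j) = Q ^ j - u / Q"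
      using Q_nonzero by (simp add: field_simps del: of_real_eq_0_iff Q_nonzero)
    ultimately have "euler_coeff (Suc j) * v ^ Suc j * qpoch_inf (u / Q ^ Suc j) q
        = - (v * (Q ^ j - u / Q) / (1 - Q ^ Suc j) * (euler_coeff j * v ^ j
          * qpoch_inf (u / Q ^ j) q))"
      unfolding euler_coeff_Suc by (simp add: mult_ac)
    then show ?thesis by (simp only: norm_minus_cancel norm_mult order_refl)
  qed
qed (rule assms)

text \<open>With \<open>b = u * p\<close>, the generating function at \<open>t = p * Q ^ j\<close>
  has numerator \<open>(u / Q ^ j;q)_\<infinity>\<close>, which \<open>qpoch_reflect\<close>
  converts into the 2phi1 coefficient. The bulk of the proof justifies interchanging the sums over
  \<open>j\<close> and \<open>k\<close>.\<close>

lemma qbessel_prod_eq_series: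
  assumes p: "p \<noteq> 0" "norm p < 1" and u: "u \<noteq> 0" and c: "c \<notin> nonpos_qpowers q"
    and z: "norm (Q powi d * u) < 1"
  shows "qbessel_prod p (u * p) c d = qpoch_inf u q * qpoch_inf c q
      / (qpoch_inf p q * qpoch_inf Q q)
    * phi21_series (Q / u) p c q (Q powi d * u)"
proof -
  define C where "C = qpoch_inf u q * qpoch_inf c q / (qpoch_inf p q * qpoch_inf Q q)"
  \<comment> \<open>The part of the argument \<open>Q powi (k + d + 1)\<close> that is free of
    \<open>k\<close>; the remaining \<open>(Q powi k) ^ j\<close> equals
    \<open>(Q ^ j) powi k\<close> and joins \<open>p powi k\<close>.\<close>
  define v where "v = Q powi (d + 1)"
  define w where "w j = euler_coeff j * qpoch_inf (c * Q ^ j) q * v ^ j / qpoch_inf Q q" for j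
  define F where "F = (\<lambda>(j, k). w j * ((p * Q ^ j) powi k * qbessel k (u * p)))"
  have v: "v = Q powi d * Q" by (simp add: v_def Q_powi_add)
  have pQ: "p * Q ^ j \<noteq> 0" "norm (p * Q ^ j) < 1" for j
    using p q_pos le_less_trans[OF mult_left_mono[OF norm_Q_power_le_1[of j], of "norm p"], of 1]
    by (simp_all add: norm_mult)
  have bp: "u * p / (p * Q ^ j) = u / Q ^ j" for j using p by simp
  \<comment> \<open>A bound uniform in \<open>j\<close>: passing from \<open>p\<close> to
    \<open>p * Q ^ j\<close> decreases the nonnegative powers, and \<open>rfact\<close> vanishes at
    negative indices.\<close>
  define M where "M = (\<Sum>\<^sub>\<infinity>n. norm (p powi n * rfact n))"
  have M: "(\<Sum>\<^sub>\<infinity>n. norm ((p * Q ^ j) powi n * rfact n)) \<le> M" for j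
    unfolding M_def
  proof (intro infsum_mono rfact_abs_summable p pQ)
    fix n
    show "norm ((p * Q ^ j) powi n * rfact n) \<le> norm (p powi n * rfact n)"
    proof (cases "n < 0")
      case False
      then obtain i where i: "n = int i" by (metis nonneg_int_cases not_less)
      have "norm (p * Q ^ j) ^ i \<le> norm p ^ i"
        using mult_left_mono[OF norm_Q_power_le_1[of j], of "norm p"]
        by (intro power_mono) (simp_all add: norm_mult)
      then show ?thesis unfolding i by (simp add: norm_mult norm_power mult_right_mono)
    qed (simp add: rfact_neg)
  qed
  have "M \<ge> 0" unfolding M_def by (rule infsum_nonneg) simp
  \<comment> \<open>The majorant of the Euler series at \<open>u / Q ^ j\<close>. It grows with
    \<open>j\<close> like the product it bounds, so it has to be weighed against
    \<open>euler_coeff j\<close>.\<close>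
  define e where "e j = norm (qpoch_inf (- complex_of_real (norm u) / Q ^ j) q)" for j
  have inner: "(\<Sum>\<^sub>\<infinity>k. norm ((p * Q ^ j) powi k * qbessel k (u * p))) \<le> M * e j" for j
  proof -
    have "- complex_of_real (norm (u / Q ^ j)) = - complex_of_real (norm u) / Q ^ j"
      by (simp add: norm_divide norm_power q_pos less_imp_le)
    then have "(\<Sum>\<^sub>\<infinity>k. norm ((p * Q ^ j) powi k * qbessel k (u * p)))
        \<le> (\<Sum>\<^sub>\<infinity>n. norm ((p * Q ^ j) powi n * rfact n)) * e j"
      using qbessel_norm_le[OF pQ, of j "u * p"] unfolding bp e_def by simp
    also have "\<dots> \<le> M * e j" by (intro mult_right_mono M) (simp add: e_def)
    finally show ?thesis .
  qed
  obtain K where K: "K > 0" "\<And>j. norm (qpoch_inf (c * Q ^ j) q) \<le> K"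
    using qpoch_inf_bounded by blast
  have F_abs: "(\<lambda>x. norm (F x)) summable_on UNIV \<times> UNIV"
    unfolding Infinite_Sum.abs_summable_on_Sigma_iff
  proof (intro conjI ballI)
    show "(\<lambda>k. norm (F (j, k))) summable_on UNIV" for j
      using qbessel_abs_summable[OF pQ, of j "u * p"]
      by (simp add: F_def norm_mult[of "w j"] summable_on_cmult_right)
    \<comment> \<open>With \<open>- norm u\<close> in place of \<open>u\<close> the critical ratio
      is still the norm of \<open>Q powi d * u\<close>, so the hypothesis \<open>z\<close> is
      exactly the condition wanted.\<close>
    have "norm (v * (- complex_of_real (norm u)) / Q) < 1"
      using z Q_nonzero by (simp add: v norm_mult norm_divide)
    then have "summable (\<lambda>j. norm (euler_coeff j * v ^ j * qpoch_inf (- complex_of_real (norm u)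
      / Q ^ j) q))"
      by (rule summable_euler_coeff_qpoch_inf)
    then have "(\<lambda>j. norm (euler_coeff j * v ^ j) * e j) summable_on UNIV"
      by (subst summable_on_UNIV_nonneg_real_iff) (auto simp: e_def norm_mult)
    then have "(\<lambda>j. K / norm (qpoch_inf Q q) * M * (norm (euler_coeff j * v ^ j) * e j))
      summable_on UNIV"
      by (rule summable_on_cmult_right)
    then show "(\<lambda>j. norm (\<Sum>\<^sub>\<infinity>k. norm (F (j, k)))) summable_on UNIV"
    proof (rule Infinite_Sum.abs_summable_on_comparison_test')
      fix j
      have "norm (\<Sum>\<^sub>\<infinity>k. norm (F (j, k))) = (\<Sum>\<^sub>\<infinity>k. norm (F (j, k)))"
        by (simp add: infsum_nonneg)
      also have "\<dots> = norm (w j) * (\<Sum>\<^sub>\<infinity>k. norm ((p * Q ^ j) powi k * qbessel k (u * p)))"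
        by (simp add: F_def norm_mult[of "w j"] infsum_cmult_right')
      also have "\<dots> \<le> norm (w j) * (M * e j)"
        by (intro mult_left_mono inner) simp
      also have "norm (w j) \<le> K / norm (qpoch_inf Q q) * norm (euler_coeff j * v ^ j)"
        using mult_right_mono[OF K(2)[of j], of "norm (euler_coeff j * v ^ j)
          / norm (qpoch_inf Q q)"]
        by (simp add: w_def norm_mult norm_divide mult_ac)
      finally show "norm (\<Sum>\<^sub>\<infinity>k. norm (F (j, k)))
        \<le> K / norm (qpoch_inf Q q) * M * (norm (euler_coeff j * v ^ j) * e j)"
        using \<open>M \<ge> 0\<close> by (simp add: mult_right_mono e_def mult_ac)
    qed
  qed
  then have s: "F summable_on UNIV \<times> UNIV" by (rule abs_summable_summable)
  have over_j: "((\<lambda>j. F (j, k)) has_sum (p powi k * qbessel (k + d) c * qbessel k (u * p))) UNIV"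
    for k
  proof -
    have "((\<lambda>j. euler_coeff j * qpoch_inf (c * Q ^ j) q * (Q powi (k + d + 1)) ^ j / qpoch_inf Q q)
      has_sum qbessel (k + d) c) UNIV"
      unfolding qbessel_def by (intro has_sum_divide_const phi11_reg_has_sum)
    from has_sum_cmult_right[OF this, of "p powi k * qbessel k (u * p)"]
    have "((\<lambda>j. p powi k * qbessel k (u * p) * (euler_coeff j * qpoch_inf (c * Q ^ j) q
      * (Q powi (k + d + 1)) ^ j / qpoch_inf Q q))
        has_sum (p powi k * qbessel (k + d) c * qbessel k (u * p))) UNIV"
      by (simp add: mult_ac)
    moreover have "p powi k * qbessel k (u * p) * (euler_coeff j * qpoch_inf (c * Q ^ j) q
      * (Q powi (k + d + 1)) ^ j / qpoch_inf Q q)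
        = F (j, k)" for j
    proof -
      have "(Q powi (k + d + 1)) ^ j = (Q powi k) ^ j * v ^ j"
        unfolding v_def by (simp add: Q_powi_add power_mult_distrib add.assoc mult_ac)
      also have "(Q powi k) ^ j = (Q ^ j) powi k"
        by (simp add: power_int_power power_int_power' mult.commute)
      finally show ?thesis
        by (simp add: F_def w_def power_int_mult_distrib)
    qed
    ultimately show ?thesis by simp
  qed
  have over_k: "((\<lambda>k. F (j, k)) has_sum (C * (phi21_coeff (Q / u) p c j * (Q powi d * u) ^ j)))
    UNIV" for j
  proof -
    have nz: "qpoch c q j \<noteq> 0" "qpoch_inf p q \<noteq> 0"
      using qpoch_nonzero[OF c] qpoch_inf_nonzero_small[OF p(2)] by auto
    \<comment> \<open>Splitting the three infinite products at \<open>j\<close> separates the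
      constant \<open>C\<close> from finite factorials.\<close>
    have p_split: "qpoch_inf p q = qpoch p q j * qpoch_inf (p * Q ^ j) q"
      by (rule qpoch_inf_split)
    have c_split: "qpoch_inf c q = qpoch c q j * qpoch_inf (c * Q ^ j) q"
      by (rule qpoch_inf_split)
    have u_split: "qpoch_inf (u / Q ^ j) q = qpoch (u / Q ^ j) q j * qpoch_inf u q"
      using qpoch_inf_split[of "u / Q ^ j" j] Q_nonzero by simp
    have "((\<lambda>k. F (j, k)) has_sum (w j * (qpoch_inf (u / Q ^ j) q / qpoch_inf (p * Q ^ j) q))) UNIV"
      unfolding F_def using has_sum_cmult_right[OF qbessel_generating[OF pQ, of j "u * p"],
        of "w j"] bp
      by simp
    moreover have "w j * (qpoch_inf (u / Q ^ j) q / qpoch_inf (p * Q ^ j) q)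
        = C * (phi21_coeff (Q / u) p c j * (Q powi d * u) ^ j)"
    proof -
      have "euler_coeff j * qpoch (u / Q ^ j) q j * v ^ j
        = ((-1) ^ j * Q ^ (j * (j - 1) div 2) * Q ^ j * qpoch (u / Q ^ j) q j) * (Q powi d) ^ j
          / qpoch Q q j"
        by (simp add: euler_coeff_def v power_mult_distrib)
      also have "\<dots> = (Q powi d * u) ^ j * qpoch (Q / u) q j / qpoch Q q j"
        unfolding qpoch_reflect[OF u] by (simp add: power_mult_distrib)
      finally have 1: "euler_coeff j * qpoch (u / Q ^ j) q j * v ^ j
        = (Q powi d * u) ^ j * qpoch (Q / u) q j / qpoch Q q j" .
      have "w j * (qpoch_inf (u / Q ^ j) q / qpoch_inf (p * Q ^ j) q)
        = (euler_coeff j * qpoch (u / Q ^ j) q j * v ^ j) * qpoch_inf u q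
          * qpoch_inf (c * Q ^ j) q / (qpoch_inf Q q * qpoch_inf (p * Q ^ j) q)"
        unfolding w_def u_split by simp
      also have "\<dots> = (Q powi d * u) ^ j * qpoch (Q / u) q j / qpoch Q q j * qpoch_inf u q
          * (qpoch_inf c q / qpoch c q j) / (qpoch_inf Q q * (qpoch_inf p q / qpoch p q j))"
      proof -
        have "qpoch_inf (c * Q ^ j) q = qpoch_inf c q / qpoch c q j"
          using c_split nz by simp
        moreover have "qpoch_inf (p * Q ^ j) q = qpoch_inf p q / qpoch p q j"
          using p_split nz by (metis mult_zero_left nonzero_mult_div_cancel_left)
        ultimately show ?thesis unfolding 1 by simp
      qed
      finally show ?thesis
        unfolding C_def phi21_coeff_def by (simp add: mult_ac)
    qed
    ultimately show ?thesis by simp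
  qed
  have "(F has_sum infsum F (UNIV \<times> UNIV)) (UNIV \<times> UNIV)" using s by simp
  from has_sum_SigmaD[OF this over_k]
  have "(\<lambda>j. C * (phi21_coeff (Q / u) p c j * (Q powi d * u) ^ j)) sums infsum F (UNIV \<times> UNIV)"
    by (rule has_sum_imp_sums)
  moreover have "(\<lambda>j. C * (phi21_coeff (Q / u) p c j * (Q powi d * u) ^ j))
      sums (C * phi21_series (Q / u) p c q (Q powi d * u))"
    unfolding phi21_series_eq by (intro sums_mult summable_sums phi21_summable c z)
  ultimately have 1: "infsum F (UNIV \<times> UNIV) = C * phi21_series (Q / u) p c q (Q powi d * u)"
    by (rule sums_unique2)
  have "((\<lambda>(k, j). F (j, k)) has_sum infsum F (UNIV \<times> UNIV)) (UNIV \<times> UNIV)"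
    using s by (subst has_sum_swap[symmetric]) simp
  from has_sum_SigmaD[OF this, of "\<lambda>k. p powi k * qbessel (k + d) c * qbessel k (u * p)"] over_j
  have "((\<lambda>k. p powi k * qbessel (k + d) c * qbessel k (u * p))
    has_sum infsum F (UNIV \<times> UNIV)) UNIV"
    by simp
  then have "qbessel_prod p (u * p) c d = infsum F (UNIV \<times> UNIV)"
    unfolding qbessel_prod_def by (rule infsumI)
  with 1 show ?thesis unfolding C_def by simp
qed

text \<open>The series formula holds for large \<open>d\<close>, and both sides satisfy the same three-term
  recurrence in \<open>d\<close>, which determines the value at \<open>d\<close> from those at \<open>d + 1\<close> and \<open>d + 2\<close> as long
  as \<open>Q powi d * u \<noteq> 1\<close>.\<close>

lemma qbessel_prod_eq_phi21:
  assumes p: "p \<noteq> 0" "norm p < 1" and u: "u \<noteq> 0" and c: "c \<notin> nonpos_qpowers q"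
    and z: "Q powi d * u \<notin> nonpos_qpowers q"
  shows "qbessel_prod p (u * p) c d = qpoch_inf u q * qpoch_inf c q
      / (qpoch_inf p q * qpoch_inf Q q)
    * phi21 (Q / u) p c q (Q powi d * u)"
proof -
  define C where "C = qpoch_inf u q * qpoch_inf c q / (qpoch_inf p q * qpoch_inf Q q)"
  define R where "R d = C * phi21 (Q / u) p c q (Q powi d * u)" for d
  have large: "qbessel_prod p (u * p) c d = R d" if "norm (Q powi d * u) < 1" for d
    using qbessel_prod_eq_series[OF p u c that] that by (simp add: R_def C_def phi21_def)
  have mult: "Q powi (d + int i) * u = Q powi d * u * Q ^ i" for d i
    by (simp add: Q_powi_add)
  have descend: "qbessel_prod p (u * p) c d = R d"
    if zd: "Q powi d * u \<notin> nonpos_qpowers q" and T1: "qbessel_prod p (u * p) c (d + 1) = R (d + 1)"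
      and T2: "qbessel_prod p (u * p) c (d + 2) = R (d + 2)" for d
  proof -
    define z where "z = Q powi d * u"
    have "z \<noteq> 1" using zd unfolding z_def nonpos_qpowers_iff by (metis mult_1 power_0)
    have "(1 - z) * phi21 (Q / u) p c q z
      = (1 + c / Q - (Q / u + p) * z) * phi21 (Q / u) p c q (z * Q)
        + (Q / u * p * z - c / Q) * phi21 (Q / u) p c q (z * Q\<^sup>2)"
      by (rule phi21_qdiff[OF c]) (use zd in \<open>simp add: z_def\<close>)
    moreover have "Q powi (d + 1) * u = z * Q" "Q powi (d + 2) * u = z * Q\<^sup>2"
      unfolding z_def using mult[of d 1] mult[of d 2]
        by (simp_all only: of_nat_1 of_nat_numeral power_one_right)
    then have "R d = C * phi21 (Q / u) p c q z" "R (d + 1) = C * phi21 (Q / u) p c q (z * Q)"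
      "R (d + 2) = C * phi21 (Q / u) p c q (z * Q\<^sup>2)"
      by (simp_all only: R_def z_def)
    ultimately have "(1 - z) * R d = (1 + c / Q - (Q / u + p) * z) * R (d + 1)
      + (Q / u * p * z - c / Q) * R (d + 2)"
      by algebra
    also have "\<dots> = (1 - z) * qbessel_prod p (u * p) c d"
    proof -
      \<comment> \<open>The recurrence is taken at \<open>d + 1\<close>, so it links
        \<open>d\<close>, \<open>d + 1\<close> and \<open>d + 2\<close>. The value at
        \<open>d\<close> occurs on both sides, with coefficients \<open>-1\<close> and
        \<open>-z\<close>, which collect to \<open>1 - z\<close>.\<close>
      have "Q powi (d + 1) = z * Q / u"
        using u by (simp add: z_def Q_powi_add)
      with qbessel_prod_qdiff[OF p, of c "u * p" "d + 1"] T1 T2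
      have "(1 + c / Q) * R (d + 1) - qbessel_prod p (u * p) c d - c / Q * R (d + 2)
        = z * Q / u * ((1 + u * p / Q) * R (d + 1) - p * R (d + 2)
          - u * p / (Q * p) * qbessel_prod p (u * p) c d)"
        by (simp add: add.assoc)
      also have "\<dots> = (Q / u + p) * z * R (d + 1) - Q / u * p * z * R (d + 2)
        - z * qbessel_prod p (u * p) c d"
        using u p Q_nonzero by (simp add: field_simps del: of_real_eq_0_iff Q_nonzero)
      finally show ?thesis by (simp add: algebra_simps)
    qed
    finally show ?thesis using \<open>z \<noteq> 1\<close> by simp
  qed
  have "(\<lambda>k. norm (Q powi d * u * Q ^ k)) \<longlonglongrightarrow> norm (Q powi d * u * 0)"
    by (intro tendsto_intros Q_power_LIMSEQ)
  then have "eventually (\<lambda>k. norm (Q powi d * u * Q ^ k) < 1) sequentially"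
    by (intro order_tendstoD) auto
  then obtain N where N: "\<And>k. k \<ge> N \<Longrightarrow> norm (Q powi (d + int k) * u) < 1"
    by (auto simp: eventually_at_top_linorder mult)
  have "qbessel_prod p (u * p) c (d + int k) = R (d + int k)" for k
  proof (cases "k \<ge> N")
    case True
    then show ?thesis by (intro large N)
  next
    case False
    then have "k \<le> N" by simp
    \<comment> \<open>The recurrence has order two, so the downward induction carries two
      consecutive values.\<close>
    then have "qbessel_prod p (u * p) c (d + int k) = R (d + int k) \<and>
        qbessel_prod p (u * p) c (d + int (Suc k)) = R (d + int (Suc k))"
    proof (induction k rule: inc_induct)
      case base
      then show ?case using large[OF N[of N]] large[OF N[of "Suc N"]] by simp
    next
      case (step k)
      have "Q powi (d + int k) * u \<notin> nonpos_qpowers q"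
        unfolding mult using z by (metis mult.assoc nonpos_qpowers_iff power_add)
      from descend[OF this] step.IH show ?case by (simp add: add_ac)
    qed
    then show ?thesis by simp
  qed
  from this[of 0] show ?thesis by (simp add: R_def C_def)
qed

section \<open>Passage from \<open>qbessel_prod\<close> to the stated sum\<close>

lemma bilateral_sum_eq_qbessel_prod:
  fixes s x y :: complex and n m :: int
  assumes nz: "s \<noteq> 0" "x \<noteq> 0" "y \<noteq> 0" and p: "norm (s * x * y) < 1"
    and x2: "x\<^sup>2 \<notin> nonpos_qpowers q" and y2: "y\<^sup>2 \<notin> nonpos_qpowers q"
  shows "((\<lambda>k. s powi k
        * (y powi (n + k) * (qpoch_inf (y\<^sup>2) q / qpoch_inf Q q) * phi11 (y\<^sup>2) q (Q powi (n + k + 1)))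
        * (x powi (m + k) * (qpoch_inf (x\<^sup>2) q / qpoch_inf Q q) * phi11 (x\<^sup>2) q (Q powi (m + k + 1))))
      has_sum (s powi (- m) * y powi (n - m) * qbessel_prod (s * x * y) (x\<^sup>2) (y\<^sup>2) (n - m))) UNIV"
proof -
  have qbessel_eq: "qbessel k w = qpoch_inf w q / qpoch_inf Q q * phi11 w q (Q powi (k + 1))"
    if "w \<notin> nonpos_qpowers q" for k w
    unfolding qbessel_def using qpoch_inf_times_phi11[OF that, of "Q powi (k + 1)"] by simp
  define p where "p = s * x * y"
  have "((\<lambda>k. p powi k * qbessel (k + n) (y\<^sup>2) * qbessel (k + m) (x\<^sup>2))
      has_sum (p powi (- m) * qbessel_prod p (x\<^sup>2) (y\<^sup>2) (n - m))) UNIV"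
    by (rule qbessel_prod_has_sum) (use nz p in \<open>auto simp: p_def\<close>)
  from has_sum_cmult_right[OF this, of "y powi n * x powi m"]
  have "((\<lambda>k. y powi n * x powi m * (p powi k * qbessel (k + n) (y\<^sup>2) * qbessel (k + m) (x\<^sup>2)))
      has_sum (y powi n * x powi m * (p powi (- m) * qbessel_prod p (x\<^sup>2) (y\<^sup>2) (n - m)))) UNIV" .
  \<comment> \<open>The factor \<open>p powi (- m)\<close> cancels \<open>x powi m\<close> and
    leaves \<open>s powi (- m) * y powi (n - m)\<close>.\<close>
  moreover have "y powi n * x powi m * (p powi (- m) * qbessel_prod p (x\<^sup>2) (y\<^sup>2) (n - m))
      = s powi (- m) * y powi (n - m) * qbessel_prod p (x\<^sup>2) (y\<^sup>2) (n - m)"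
    using nz by (simp add: p_def power_int_mult_distrib power_int_diff power_int_minus field_simps)
  moreover have "y powi n * x powi m * (p powi k * qbessel (k + n) (y\<^sup>2) * qbessel (k + m) (x\<^sup>2))
      = s powi k
        * (y powi (n + k) * (qpoch_inf (y\<^sup>2) q / qpoch_inf Q q) * phi11 (y\<^sup>2) q (Q powi (n + k + 1)))
        * (x powi (m + k) * (qpoch_inf (x\<^sup>2) q / qpoch_inf Q q) * phi11 (x\<^sup>2) q (Q powi (m + k + 1)))"
    for k
    using nz by (simp add: qbessel_eq[OF x2] qbessel_eq[OF y2] p_def power_int_mult_distrib
      power_int_add mult_ac add.commute[of k])
  ultimately show ?thesis by (simp only: p_def)
qed

lemma bilateral_sum_eq_phi21:
  fixes s x y :: complex and n m :: int
  assumes nz: "s \<noteq> 0" "x \<noteq> 0" "y \<noteq> 0" and p: "norm (s * x * y) < 1"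
    and x2: "x\<^sup>2 \<notin> nonpos_qpowers q" and y2: "y\<^sup>2 \<notin> nonpos_qpowers q"
    and z: "Q powi (n - m) * (inverse s * x * inverse y) \<notin> nonpos_qpowers q"
  shows "((\<lambda>k. s powi k
        * (y powi (n + k) * (qpoch_inf (y\<^sup>2) q / qpoch_inf Q q) * phi11 (y\<^sup>2) q (Q powi (n + k + 1)))
        * (x powi (m + k) * (qpoch_inf (x\<^sup>2) q / qpoch_inf Q q) * phi11 (x\<^sup>2) q (Q powi (m + k + 1))))
      has_sum (s powi (- m) * y powi (n - m)
        * ((qpoch_inf (inverse s * x * inverse y) q * qpoch_inf (y\<^sup>2) q)
            / (qpoch_inf (s * x * y) q * qpoch_inf Q q))
        * phi21 (Q * s * inverse x * y) (s * x * y) (y\<^sup>2) q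
            (Q powi (n - m) * (inverse s * x * inverse y)))) UNIV"
proof -
  \<comment> \<open>This \<open>u\<close> is \<open>x\<^sup>2\<close> divided by
    \<open>s * x * y\<close>, which puts the sum in the form \<open>qbessel_prod p (u * p)\<close>
    evaluated above.\<close>
  define u where "u = inverse s * x * inverse y"
  have u: "u \<noteq> 0" and x_eq: "x\<^sup>2 = u * (s * x * y)" and a: "Q * s * inverse x * y = Q / u"
    using nz by (simp_all add: u_def field_simps power2_eq_square)
  have "qbessel_prod (s * x * y) (x\<^sup>2) (y\<^sup>2) (n - m)
    = qpoch_inf u q * qpoch_inf (y\<^sup>2) q / (qpoch_inf (s * x * y) q * qpoch_inf Q q)
      * phi21 (Q / u) (s * x * y) (y\<^sup>2) q (Q powi (n - m) * u)"
    unfolding x_eq by (rule qbessel_prod_eq_phi21) (use nz p y2 u z in \<open>auto simp: u_def\<close>)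
  with bilateral_sum_eq_qbessel_prod[OF nz p x2 y2, of n m] show ?thesis
    unfolding u_def[symmetric] a by (simp add: mult.assoc)
qed

end

theorem proposition4p2:
  fixes q :: real and s x y :: complex and n m :: int
  assumes "0 < q" and "q < 1"
    and "s \<noteq> 0" and "x \<noteq> 0" and "y \<noteq> 0"
    and "norm (s * x * y) < 1"
    and "x\<^sup>2 \<notin> nonpos_qpowers q" and "y\<^sup>2 \<notin> nonpos_qpowers q"
  shows
    "let Q = complex_of_real q;
         f = (\<lambda>k::int.
                s powi k
                * (y powi (n + k) * (qpoch_inf (y\<^sup>2) q / qpoch_inf Q q)
                   * phi11 (y\<^sup>2) q (Q powi (n + k + 1)))
                * (x powi (m + k) * (qpoch_inf (x\<^sup>2) q / qpoch_inf Q q)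
                   * phi11 (x\<^sup>2) q (Q powi (m + k + 1))));
         S = (\<Sum>\<^sub>\<infinity>k\<in>UNIV. f k);
         u = inverse s * x * inverse y;
         v = inverse s * y * inverse x;
         cond1 = (u \<notin> nonpos_qpowers q \<and> Q powi (n - m) * u \<notin> nonpos_qpowers q);
         cond2 = (v \<notin> nonpos_qpowers q \<and> Q powi (m - n) * v \<notin> nonpos_qpowers q);
         R1 = s powi (- m) * y powi (n - m)
              * ((qpoch_inf u q * qpoch_inf (y\<^sup>2) q) / (qpoch_inf (s * x * y) q * qpoch_inf Q q))
              * phi21 (Q * s * inverse x * y) (s * x * y) (y\<^sup>2) q (Q powi (n - m) * u);
         R2 = s powi (- n) * x powi (m - n)
              * ((qpoch_inf v q * qpoch_inf (x\<^sup>2) q) / (qpoch_inf (s * x * y) q * qpoch_inf Q q))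
              * phi21 (Q * s * x * inverse y) (s * x * y) (x\<^sup>2) q (Q powi (m - n) * v)
     in f summable_on UNIV
        \<and> (cond1 \<longrightarrow> S = R1)
        \<and> (cond2 \<longrightarrow> S = R2)
        \<and> (cond1 \<and> cond2 \<longrightarrow> R1 = R2)"
proof -
  interpret q_base q by unfold_locales (use assms in auto)
  note sum1 = bilateral_sum_eq_qbessel_prod[OF assms(3-8), of n m]
  have p': "norm (s * y * x) < 1" using assms(6) by (simp add: mult_ac)
  note eq1 = infsumI[OF bilateral_sum_eq_phi21[OF assms(3-8), of n m]]
  note eq2 = infsumI[OF bilateral_sum_eq_phi21[OF assms(3,5,4) p' assms(8,7), of m n]]
  \<comment> \<open>Exchanging \<open>(n, y)\<close> with \<open>(m, x)\<close> permutes the two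
    factors of the summand and the letters in the parameters; these identities reconcile the
    instance with the stated form of (ii).\<close>
  have swap: "s powi k * X * Y = s powi k * Y * X" "s * y * x = s * x * y"
    "Q * s * inverse y * x = Q * s * x * inverse y" for k X Y
    by (simp_all add: mult_ac)
  show ?thesis
    unfolding Let_def
    using sum1 eq1 eq2[unfolded swap(2,3)] by (auto simp: summable_on_def swap(1))
qed

end
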